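(* Let $m \geq 1$ and let $X_0 \xrightarrow{f_1} X_1 \xrightarrow{f_2} \cdots \xrightarrow{f_m} X_m$ be arbitrary maps between abelian groups, $x \in X_0$, $S$ a finite set, $u=(u_s)_{s \in S}$ a family of directions in $X_0$, $\gamma \in \mathbb{N}_0^S$, and $z = (f_m \circ \cdots \circ f_1)(x)$. Then: (1) If $S \neq \emptyset$, $$\Delta(f_m \circ \cdots \circ f_1;\, x;\, (u_s)_{s\in S}) = \sum_{K \in \mathrm{Cov}_m(S)} \Delta^{K}(f_1, \dots, f_m;\, x;\, u).$$ (2) $$\Delta(f_m \circ \cdots \circ f_1;\, x;\, u^\gamma) = \sum_{\kappa \in \mathcal{M}_+^m(S)} \mathrm{Cov}_m(\gamma, \kappa)\, \Delta^{\kappa}(f_1, \dots, f_m;\, x;\, u).$$ (3) $$(f_m \circ \cdots \circ f_1)\big(x + \textstyle\sum_{s} \gamma_s u_s\big) = z + \sum_{\kappa \in \mathcal{M}_+^m(S)} \mathrm{Pow}_m(\gamma, \kappa)\, \Delta^{\kappa}(f_1, \dots, f_m;\, x;\, u).$$ (4) The two coefficient systems are Möbius inverses of each other in $\gamma$: for every $\kappa \in \mathcal{M}_+^m(S)$, $$\mathrm{Cov}_m(\gamma, \kappa) = \sum_{\beta \leq \gamma} (-1)^{\mathrm{wt}(\gamma - \beta)} \binom{\gamma}{\beta}\, \mathrm{Pow}_m(\beta, \kappa), \qquad \mathrm{Pow}_m(\gamma,\kappa) = \sum_{\beta \leq \gamma} \binom{\gamma}{\beta}\,\mathrm{Cov}_m(\beta,\kappa).$$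 (5) Both satisfy explicit level recursions in $m$: for $\alpha \in \mathcal{M}_+(S)$, $\mathrm{Pow}_1(\gamma, \alpha) = \binom{\gamma}{\alpha}$ and $\mathrm{Cov}_1(\gamma, \alpha) = \delta_{\gamma, \alpha}$; and for $m \geq 2$ and $\kappa \in \mathcal{M}_+^m(S)$, $$\mathrm{Pow}_m(\gamma, \kappa) = \frac{1}{\kappa!} \prod_{\lambda \in \mathrm{Supp}(\kappa)} \big(\mathrm{Pow}_{m-1}(\gamma, \lambda)\big)_{\kappa(\lambda)},$$ $$\mathrm{Cov}_m(\gamma, \kappa) = \sum_{\beta \leq \gamma} (-1)^{\mathrm{wt}(\gamma - \beta)} \binom{\gamma}{\beta} \frac{1}{\kappa!} \prod_{\lambda \in \mathrm{Supp}(\kappa)} \Big(\sum_{\alpha \leq \beta} \binom{\beta}{\alpha}\, \mathrm{Cov}_{m-1}(\alpha, \lambda)\Big)_{\kappa(\lambda)}.$$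
   Context: Forward differences: for a map $h: A \to B$ of abelian groups, $a \in A$ and a finite family $(w_i)_{i\in I}$ in $A$ (repetitions allowed), $\Delta(h; a; (w_i)_{i \in I}) := \sum_{T \subseteq I} (-1)^{|I|-|T|} h(a + \sum_{i \in T} w_i)$. For $u=(u_s)_{s\in S}$ and $T\subseteq S$, $u_T=(u_s)_{s\in T}$; for $\gamma\in\mathbb{N}_0^S$, $u^\gamma$ is the family in which each $u_s$ is repeated $\gamma_s$ times. Multi-indices: $\beta \le \gamma$ is componentwise, $\mathrm{wt}(\gamma)=\sum_s\gamma_s$. $(n)_r = n(n-1)\cdots(n-r+1)$ is the falling factorial and $\binom{\gamma}{\beta}=\prod_s \binom{\gamma_s}{\beta_s}$. $\delta_{\gamma,\alpha}$ is the Kronecker delta. The slot set of $\gamma$ is $S(\gamma)=\{(s,i): s\in S,\ 0<i\le\gamma_s\}$. Higher power sets: $\mathcal{P}_+(S)$ is the set of nonempty subsets of $S$; $\mathcal{P}_+^1(S)=\mathcal{P}_+(S)$, $\mathcal{P}_+^r(S)=\mathcal{P}_+(\mathcal{P}_+^{r-1}(S))$ for $r\ge2$. For $K\in\mathcal{P}_+^r(S)$ the leaf support $\mathrm{leaf}(K)\subseteq S$ is $K$ if $r=1$ and $\bigcup_{L\in K}\mathrm{leaf}(L)$ if $r\geq 2$. The set of $r$-fold coverings is $\mathrm{Cov}_r(S)=\{K\in\mathcal{P}_+^r(S):\mathrm{leaf}(K)=S\}$. Higher multi-indices: for a set $A$, $\mathcal{M}_+(A)$ is the set of nonzero finitely supported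 maps $A\to\mathbb{N}_0$; $\mathcal{M}_+^1(S)=\mathcal{M}_+(S)$, $\mathcal{M}_+^{r}(S)=\mathcal{M}_+(\mathcal{M}_+^{r-1}(S))$ for $r\geq 2$. $\mathrm{Supp}(\kappa)=\{\lambda:\kappa(\lambda)>0\}$ and $\kappa!=\prod_{\lambda\in\mathrm{Supp}(\kappa)}\kappa(\lambda)!$. Profile map $\nu:\mathcal{P}_+^m(S(\gamma))\to\mathcal{M}_+^m(S)$: for $m=1$, $\nu(T)_s=\#\{i:(s,i)\in T\}$; for $m\ge2$, $\nu(K)(\lambda)=\#\{L\in K:\nu(L)=\lambda\}$. Coefficients: $\mathrm{Pow}_m(\gamma,\kappa)=\#\{K\in\mathcal{P}_+^m(S(\gamma)):\nu(K)=\kappa\}$ and $\mathrm{Cov}_m(\gamma,\kappa)=\#\{K\in\mathrm{Cov}_m(S(\gamma)):\nu(K)=\kappa\}$. For fixed $\gamma$ only finitely many $\kappa$ give nonzero coefficients. Iterated increments: put $x_r=(f_r\circ\cdots\circ f_1)(x)$. For $T\in\mathcal{P}_+(S)$, $\Delta^T(f_1;x;u)=\Delta(f_1;x;u_T)$; for $r\ge2$ and $K\in\mathcal{P}_+^r(S)$, $\Delta^K(f_1,\dots,f_r;x;u)=\Delta\big(f_r;x_{r-1};(\Delta^L(f_1,\dots,f_{r-1};x;u))_{L\in K}\big)$. For $\alpha\in\mathcal{M}_+(S)$, $\Delta^\alpha(f_1;x;u)=\Delta(f_1;x;u^\alpha)$; for $r\ge2$ and $\kappa\in\mathcal{M}_+^r(S)$,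 $\Delta^\kappa(f_1,\dots,f_r;x;u)$ is $\Delta(f_r;x_{r-1};\,\cdot\,)$ evaluated at the direction family in which each $\Delta^\lambda(f_1,\dots,f_{r-1};x;u)$, $\lambda\in\mathrm{Supp}(\kappa)$, is repeated $\kappa(\lambda)$ times.
   Formalization: Part (2) is proved for γ ≠ 0 only: at γ = 0 the printed identity fails, since the left side is z while every Cov_m(0,κ) is 0, so the right side is 0 (e.g. m = 1 and f_1 a nonzero constant). *)

theory Defs
  imports Complex_Main "HOL-Algebra.Ring" "HOL-Library.Multiset" "HOL-Library.FSet"
begin

text \<open>
  Abelian groups are given additively, by the locale \<^locale>\<open>abelian_group\<close>; the multiplicative
  part of the underlying record plays no role. A family of directions is a map \<open>w\<close> on a finite
  index set \<open>I\<close>, so repetitions are possible.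
\<close>

definition fwd_diff ::
    "('a, 'm) ring_scheme \<Rightarrow> ('b, 'n) ring_scheme \<Rightarrow> ('a \<Rightarrow> 'b) \<Rightarrow> 'a \<Rightarrow> 'i set \<Rightarrow> ('i \<Rightarrow> 'a) \<Rightarrow> 'b"
  where "fwd_diff A B h a I w =
    (\<Oplus>\<^bsub>B\<^esub>T\<in>Pow I. [((-1) ^ (card I - card T) :: int)] \<cdot>\<^bsub>B\<^esub> h (a \<oplus>\<^bsub>A\<^esub> (\<Oplus>\<^bsub>A\<^esub>i\<in>T. w i)))"

primrec iter_map :: "(nat \<Rightarrow> 'a \<Rightarrow> 'a) \<Rightarrow> nat \<Rightarrow> 'a \<Rightarrow> 'a" where
  "iter_map f 0 x = x"
| "iter_map f (Suc r) x = f (Suc r) (iter_map f r x)"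

text \<open>
  Multi-indices with finite support are multisets: the entry at \<open>s\<close> is \<^term>\<open>count \<gamma> s\<close>, the
  support is \<^term>\<open>set_mset \<gamma>\<close>, the weight is \<^term>\<open>size \<gamma>\<close>, and \<^term>\<open>\<beta> \<subseteq># \<gamma>\<close> is the componentwise
  order. An element of \<open>\<nat>\<^sub>0\<^sup>S\<close> is a multiset with support contained in \<open>S\<close>.
\<close>

definition slots :: "'a multiset \<Rightarrow> ('a \<times> nat) set"
  where "slots \<gamma> = {(s, i). 0 < i \<and> i \<le> count \<gamma> s}"

definition mbinom :: "'s set \<Rightarrow> 's multiset \<Rightarrow> 's multiset \<Rightarrow> nat"
  where "mbinom S \<gamma> \<beta> = (\<Prod>s\<in>S. count \<gamma> s choose count \<beta> s)"

definition mfact :: "'a multiset \<Rightarrow> nat"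
  where "mfact \<kappa> = (\<Prod>a\<in>set_mset \<kappa>. fact (count \<kappa> a))"

definition falling :: "rat \<Rightarrow> nat \<Rightarrow> rat"
  where "falling a r = (\<Prod>i<r. a - of_nat i)"

text \<open>
  The level \<open>r\<close> of an iterated power set is a variable, so all levels live in one datatype:
  \<open>PBase\<close> forms the elements of level \<open>1\<close> and \<open>PNode\<close> those of level \<open>\<ge> 2\<close>. For finite \<open>S\<close>, the
  only case of interest, all sets occurring are finite, whence the use of \<^type>\<open>fset\<close>.
  Level \<open>0\<close> is not meaningful and is left empty.
\<close>

datatype 's hset = PBase "'s fset" | PNode "'s hset fset"

fun hpow :: "nat \<Rightarrow> 's set \<Rightarrow> 's hset set" where
  "hpow 0 S = {}"
| "hpow (Suc 0) S = {PBase T |T. T \<noteq> {||} \<and> fset T \<subseteq> S}"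
| "hpow (Suc (Suc r)) S = {PNode K |K. K \<noteq> {||} \<and> fset K \<subseteq> hpow (Suc r) S}"

primrec leaf :: "'s hset \<Rightarrow> 's set" where
  "leaf (PBase T) = fset T"
| "leaf (PNode K) = \<Union> (fset (fimage leaf K))"

definition coverings :: "nat \<Rightarrow> 's set \<Rightarrow> 's hset set"
  where "coverings r S = {K \<in> hpow r S. leaf K = S}"

datatype 's hindex = MBase "'s multiset" | MNode "'s hindex multiset"

fun hmulti :: "nat \<Rightarrow> 's set \<Rightarrow> 's hindex set" where
  "hmulti 0 S = {}"
| "hmulti (Suc 0) S = {MBase \<alpha> |\<alpha>. \<alpha> \<noteq> {#} \<and> set_mset \<alpha> \<subseteq> S}"
| "hmulti (Suc (Suc r)) S = {MNode \<kappa> |\<kappa>. \<kappa> \<noteq> {#} \<and> set_mset \<kappa> \<subseteq> hmulti (Suc r) S}"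

lemma size_hset_member: "L \<in> fset K \<Longrightarrow> size L < size (PNode K)"
  using member_le_sum[of L "fset K" "\<lambda>x. Suc (size x)"] by simp

text \<open>
  The profile counts, with multiplicity, the members having a given value; the lemmas
  \<open>count_profile_PBase\<close> and \<open>count_profile_PNode\<close> spell this out.
\<close>

function profile :: "('s \<times> nat) hset \<Rightarrow> 's hindex" where
  "profile (PBase T) = MBase (image_mset fst (mset_set (fset T)))"
| "profile (PNode K) = MNode (image_mset profile (mset_set (fset K)))"
  by pat_completeness auto
termination
  by (relation "measure size") (auto intro: size_hset_member simp del: hset.size)

lemma count_profile_PBase:
  "profile (PBase T) = MBase \<alpha> \<Longrightarrow> count \<alpha> s = card {i. (s, i) \<in> fset T}"
proof -
  assume "profile (PBase T) = MBase \<alpha>"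
  then have "count \<alpha> s = card {p \<in> fset T. fst p = s}"
    by (auto simp: count_image_mset' sum.If_cases Int_def intro!: arg_cong[where f = card])
  also have "{p \<in> fset T. fst p = s} = Pair s ` {i. (s, i) \<in> fset T}"
    by auto
  also have "card \<dots> = card {i. (s, i) \<in> fset T}"
    by (simp add: card_image inj_on_def)
  finally show ?thesis .
qed

lemma count_profile_PNode:
  "profile (PNode K) = MNode \<kappa> \<Longrightarrow> count \<kappa> \<mu> = card {L \<in> fset K. profile L = \<mu>}"
  by (auto simp: count_image_mset' intro!: arg_cong[where f = card])

definition Pow_coeff :: "nat \<Rightarrow> 's multiset \<Rightarrow> 's hindex \<Rightarrow> nat"
  where "Pow_coeff m \<gamma> \<kappa> = card {K \<in> hpow m (slots \<gamma>). profile K = \<kappa>}"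

definition Cov_coeff :: "nat \<Rightarrow> 's multiset \<Rightarrow> 's hindex \<Rightarrow> nat"
  where "Cov_coeff m \<gamma> \<kappa> = card {K \<in> coverings m (slots \<gamma>). profile K = \<kappa>}"

text \<open>
  For fixed \<open>\<gamma>\<close> only finitely many coefficients are nonzero. Since \<^const>\<open>finsum\<close> over an infinite
  index set is zero by convention, sums over all higher multi-indices are to be taken over those
  with nonzero coefficient.
\<close>

lemma finite_slots: "finite (slots \<gamma>)"
proof -
  have "slots \<gamma> \<subseteq> (SIGMA s:set_mset \<gamma>. {..count \<gamma> s})"
    by (auto simp: slots_def simp flip: count_greater_zero_iff)
  then show ?thesis
    by (rule finite_subset) auto
qed

lemma finite_hpow: "finite S \<Longrightarrow> finite (hpow m S)"
proof (induction m S rule: hpow.induct)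
  case (2 S)
  then have "finite {T. fset T \<subseteq> S}"
    using finite_vimageI[of "Pow S" fset] by (simp add: vimage_def fset_inject inj_on_def)
  then show ?case by simp
next
  case (3 r S)
  then have "finite {K. fset K \<subseteq> hpow (Suc r) S}"
    using finite_vimageI[of "Pow (hpow (Suc r) S)" fset]
    by (simp add: vimage_def fset_inject inj_on_def)
  then show ?case by simp
qed simp

lemma finite_Pow_coeff_support: "finite {\<kappa>. Pow_coeff m \<gamma> \<kappa> \<noteq> 0}"
proof (rule finite_subset)
  show "{\<kappa>. Pow_coeff m \<gamma> \<kappa> \<noteq> 0} \<subseteq> profile ` hpow m (slots \<gamma>)"
    by (auto simp: Pow_coeff_def card_eq_0_iff)
qed (simp add: finite_hpow finite_slots)

lemma finite_Cov_coeff_support: "finite {\<kappa>. Cov_coeff m \<gamma> \<kappa> \<noteq> 0}"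
proof (rule finite_subset)
  show "{\<kappa>. Cov_coeff m \<gamma> \<kappa> \<noteq> 0} \<subseteq> profile ` hpow m (slots \<gamma>)"
    by (auto simp: Cov_coeff_def coverings_def card_eq_0_iff)
qed (simp add: finite_hpow finite_slots)

text \<open>
  The groups are \<open>X 0, X 1, \<dots>\<close>, realised on carriers inside one type, and \<open>f i\<close> maps \<open>X (i - 1)\<close>
  to \<open>X i\<close>. The level argument of the increments is that of the element of
  \<^const>\<open>hpow\<close> or \<^const>\<open>hmulti\<close>; other combinations are left unspecified.
\<close>

fun incr_set ::
    "(nat \<Rightarrow> ('a, 'm) ring_scheme) \<Rightarrow> (nat \<Rightarrow> 'a \<Rightarrow> 'a) \<Rightarrow> 'a \<Rightarrow> ('s \<Rightarrow> 'a) \<Rightarrow> nat \<Rightarrow> 's hset \<Rightarrow> 'a"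
  where
  "incr_set X f x u (Suc 0) (PBase T) = fwd_diff (X 0) (X 1) (f 1) x (fset T) u"
| "incr_set X f x u (Suc (Suc r)) (PNode K) =
    fwd_diff (X (Suc r)) (X (Suc (Suc r))) (f (Suc (Suc r))) (iter_map f (Suc r) x)
      (fset K) (\<lambda>L. incr_set X f x u (Suc r) L)"

text \<open>
  The family in which each \<open>w a\<close> is repeated \<^term>\<open>count \<kappa> a\<close> times is the map \<^term>\<open>\<lambda>(a, i::nat). w a\<close>
  on the index set \<^term>\<open>slots \<kappa>\<close>.
\<close>

fun incr_multi ::
    "(nat \<Rightarrow> ('a, 'm) ring_scheme) \<Rightarrow> (nat \<Rightarrow> 'a \<Rightarrow> 'a) \<Rightarrow> 'a \<Rightarrow> ('s \<Rightarrow> 'a) \<Rightarrow> nat \<Rightarrow> 's hindex \<Rightarrow> 'a"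
  where
  "incr_multi X f x u (Suc 0) (MBase \<alpha>) =
    fwd_diff (X 0) (X 1) (f 1) x (slots \<alpha>) (\<lambda>(s, i). u s)"
| "incr_multi X f x u (Suc (Suc r)) (MNode \<kappa>) =
    fwd_diff (X (Suc r)) (X (Suc (Suc r))) (f (Suc (Suc r))) (iter_map f (Suc r) x)
      (slots \<kappa>) (\<lambda>(l, i). incr_multi X f x u (Suc r) l)"

end

theory Submission
  imports Defs
begin

text \<open>
  Forward differences are exactly the Moebius transform over subsets: the function
  \<open>T \<mapsto> h (a + \<Sum>\<^sub>T w)\<close> on finite index sets is recovered by summing the differences
  \<open>\<Delta>(h; a; w\<^sub>T)\<close> over all \<open>T \<subseteq> I\<close> (\<open>finsum_fwd_diff\<close>). Splitting off \<open>T = {}\<close>, this says that applying \<open>h\<close>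
  to \<open>a\<close> plus a sum of directions gives \<open>h a\<close> plus a sum, over the nonempty subsets of the
  index set, of new directions in the target group. The output has the same shape as the input,
  so the identity can be fed into the next map of the chain: the directions produced at level \<open>r\<close> are
  indexed by \<^term>\<open>hpow r S\<close>, and induction on the level expands
  \<open>f\<^sub>m \<circ> \<dots> \<circ> f\<^sub>1\<close> at \<open>x + \<Sum>\<^sub>S u\<close> as a sum over \<^term>\<open>hpow m S\<close> (\<open>iter_map_expansion\<close>).

  Sorting the iterated subsets by their leaf support shows that this expansion, read for every
  \<open>T \<subseteq> S\<close>, is a sum over the subsets of \<open>T\<close> of sums over coverings. The differences of the composite
  have the same subset sums, and a function of finite sets is determined by its subset
  sums; this is the covering formula (\<open>fwd_diff_iter_map\<close>).

  Repeated directions are the special case in which the index set is \<^term>\<open>slots \<gamma>\<close> and the direction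
  depends only on the first component of a slot. An iterated increment then depends only on the profile
  of the iterated subset (\<open>incr_set_eq_incr_multi_profile\<close>), because a finite set whose elements carry
  labels is in label-preserving bijection with the slots of its multiset of labels. Collecting equal
  terms produces the coefficients \<^const>\<open>Cov_coeff\<close> and \<^const>\<open>Pow_coeff\<close>.

  The statements on coefficients are counting. One lemma, \<open>card_subsets_content\<close>, counts the subsets
  of a labelled finite set with a prescribed multiset of labels, as a product of binomial coefficients.
  Applied to slots labelled by their first component it gives the base case, and applied to
  \<^term>\<open>hpow r T\<close> labelled by profile it gives the level recursion for \<^const>\<open>Pow_coeff\<close>. The recursion also
  shows that the number of iterated subsets of \<open>T\<close> with given profile depends only on the multiset
  of labels of \<open>T\<close>. Hence Moebius inversion over subsets of \<^term>\<open>slots \<gamma>\<close>, between all iterated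
  subsets and the covering ones, collapses to sums over \<open>\<beta> \<subseteq># \<gamma>\<close> in which each \<open>\<beta>\<close> is weighted
  by the number \<^term>\<open>mbinom S \<gamma> \<beta>\<close> of subsets with that multiset of labels.
\<close>

section \<open>Counting subsets of a labelled set\<close>

text \<open>
  The map \<open>p\<close> labels the elements of \<open>T\<close>. With \<open>p = fst\<close> this is the
  profile of a set of slots, with \<open>p = profile\<close> that of a set of iterated subsets.
\<close>

abbreviation content :: "('b \<Rightarrow> 'c) \<Rightarrow> 'b set \<Rightarrow> 'c multiset"
  where "content p T \<equiv> image_mset p (mset_set T)"

lemma count_content:
  "finite T \<Longrightarrow> count (content p T) v = card {t \<in> T. p t = v}"
  by (simp add: count_image_mset' conj_commute eq_commute[of v])

lemma content_slots: "content fst (slots \<gamma>) = \<gamma>"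
proof (rule multiset_eqI)
  fix s
  have "{t \<in> slots \<gamma>. fst t = s} = Pair s ` {0<..count \<gamma> s}"
    by (auto simp: slots_def)
  then show "count (content fst (slots \<gamma>)) s = count \<gamma> s"
    by (simp add: count_content finite_slots card_image inj_on_def)
qed

lemma content_mono:
  "T' \<subseteq> T \<Longrightarrow> finite T \<Longrightarrow> content p T' \<subseteq># content p T"
  by (simp add: image_mset_subseteq_mono subset_imp_msubset_mset_set)

text \<open>
  Every submultiset of \<open>\<gamma>\<close> is the multiset of labels of a subset of the finite set \<^term>\<open>slots \<gamma>\<close>.
\<close>

lemma finite_submultisets: "finite {\<beta>. \<beta> \<subseteq># \<gamma>}"
proof (rule finite_subset)
  show "{\<beta>. \<beta> \<subseteq># \<gamma>} \<subseteq> (\<lambda>T. content fst T) ` Pow (slots \<gamma>)"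
  proof
    fix \<beta> assume "\<beta> \<in> {\<beta>. \<beta> \<subseteq># \<gamma>}"
    then have "slots \<beta> \<subseteq> slots \<gamma>"
      by (auto simp: slots_def subseteq_mset_def intro: order_trans)
    then show "\<beta> \<in> (\<lambda>T. content fst T) ` Pow (slots \<gamma>)"
      using content_slots[of \<beta>] by (metis Pow_iff image_eqI)
  qed
qed (simp add: finite_slots)

text \<open>
  A subset with label multiset \<open>\<alpha>\<close> amounts to an independent choice, for every label \<open>v\<close>, of
  \<^term>\<open>count \<alpha> v\<close> among the elements labelled \<open>v\<close>. The proof adds the elements of \<open>T\<close> one at
  a time: if \<open>p t\<close> occurs in \<open>\<alpha>\<close>, the subsets avoiding or containing the new element \<open>t\<close> match the two
  terms of Pascal's rule in the factor for the label \<open>p t\<close>, while all other factors are unchanged.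
\<close>

lemma card_subsets_content:
  fixes p :: "'b \<Rightarrow> 'c"
  assumes "finite T" "finite V" "set_mset \<alpha> \<subseteq> V"
  shows "card {T'. T' \<subseteq> T \<and> content p T' = \<alpha>} =
    (\<Prod>v\<in>V. count (content p T) v choose count \<alpha> v)"
  using assms(1,3)
proof (induction T arbitrary: \<alpha> rule: finite_induct)
  case empty
  show ?case
  proof (cases "\<alpha> = {#}")
    case True
    then have "{T'. T' \<subseteq> {} \<and> content p T' = \<alpha>} = {{}}" by auto
    with True show ?thesis by simp
  next
    case False
    then obtain v where "v \<in># \<alpha>" by (meson multiset_nonemptyE)
    with empty have "v \<in> V" "count \<alpha> v \<noteq> 0" by auto
    moreover from False have "{T'. T' \<subseteq> {} \<and> content p T' = \<alpha>} = {}" by auto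
    ultimately show ?thesis
      using assms(2) by (simp only:) (auto simp: prod_zero_iff intro!: bexI[of _ v])
  qed
next
  case (insert t T)
  let ?N = "\<lambda>\<alpha>. {T'. T' \<subseteq> T \<and> content p T' = \<alpha>}"
  let ?I = "{T'. T' \<subseteq> T \<and> add_mset (p t) (content p T') = \<alpha>}"
  have content_insert: "content p (insert t T') = add_mset (p t) (content p T')"
    if "T' \<subseteq> T" for T'
    using that insert.hyps by (subst mset_set.insert) (auto dest: finite_subset)
  have split: "{T'. T' \<subseteq> insert t T \<and> content p T' = \<alpha>} = ?N \<alpha> \<union> insert t ` ?I"
    (is "?L = ?R")
  proof
    show "?L \<subseteq> ?R"
    proof
      fix T' assume T': "T' \<in> ?L"
      show "T' \<in> ?R"
      proof (cases "t \<in> T'")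
        case True
        then obtain U where U: "T' = insert t U" "t \<notin> U" by (meson Set.set_insert)
        with T' have "U \<subseteq> T" by auto
        with U T' show ?thesis by (auto simp: content_insert)
      qed (use T' in auto)
    qed
  qed (auto simp: content_insert)
  have fin: "finite (?N \<alpha>)" "finite ?I" using insert.hyps(1) by auto
  have "card {T'. T' \<subseteq> insert t T \<and> content p T' = \<alpha>} = card (?N \<alpha>) + card (insert t ` ?I)"
    unfolding split using insert.hyps(2) fin by (intro card_Un_disjoint) auto
  also have "card (insert t ` ?I) = card ?I"
  proof (intro card_image inj_onI)
    fix U U' assume "U \<in> ?I" "U' \<in> ?I" "insert t U = insert t U'"
    moreover from this have "t \<notin> U" "t \<notin> U'" using insert.hyps(2) by auto
    ultimately show "U = U'" using insert_ident by metis
  qed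
  also have "card (?N \<alpha>) + card ?I =
      (\<Prod>v\<in>V. count (content p (insert t T)) v choose count \<alpha> v)"
  proof (cases "p t \<in># \<alpha>")
    case True
    then obtain \<alpha>' where \<alpha>: "\<alpha> = add_mset (p t) \<alpha>'" by (meson mset_add)
    then have V: "p t \<in> V" "set_mset \<alpha>' \<subseteq> V" using insert.prems by auto
    let ?R = "\<Prod>v\<in>V - {p t}. count (content p T) v choose count \<alpha> v"
    have remove: "prod g V = g (p t) * prod g (V - {p t})" for g :: "'c \<Rightarrow> nat"
      by (rule prod.remove[OF assms(2) V(1)])
    have "?I = ?N \<alpha>'" using \<alpha> by auto
    then have "card ?I = (count (content p T) (p t) choose count \<alpha>' (p t)) *
        (\<Prod>v\<in>V - {p t}. count (content p T) v choose count \<alpha>' v)"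
      by (simp only: insert.IH[OF V(2)] remove)
    also have "(\<Prod>v\<in>V - {p t}. count (content p T) v choose count \<alpha>' v) = ?R"
      by (intro prod.cong) (auto simp: \<alpha>)
    finally have "card (?N \<alpha>) + card ?I =
        (count (content p (insert t T)) (p t) choose count \<alpha> (p t)) * ?R"
      unfolding insert.IH[OF insert.prems] remove
      by (simp add: content_insert \<alpha> algebra_simps)
    also have "?R =
        (\<Prod>v\<in>V - {p t}. count (content p (insert t T)) v choose count \<alpha> v)"
      by (intro prod.cong) (auto simp: content_insert)
    finally show ?thesis by (simp only: remove)
  next
    case False
    then have "?I = {}" by auto
    then have "card (?N \<alpha>) + card ?I = (\<Prod>v\<in>V. count (content p T) v choose count \<alpha> v)"
      by (simp only: insert.IH[OF insert.prems] card.empty add_0_right)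
    also have "\<dots> = (\<Prod>v\<in>V. count (content p (insert t T)) v choose count \<alpha> v)"
      using False by (intro prod.cong) (auto simp: content_insert not_in_iff)
    finally show ?thesis .
  qed
  finally show ?case .
qed

text \<open>
  Turns sums over subsets into sums over multi-indices: the subsets are grouped by
  their multiset of labels, and the previous lemma gives the size of each group.
\<close>

lemma sum_subsets_content:
  fixes h :: "'s multiset \<Rightarrow> 'r :: comm_semiring_1"
  assumes "finite T" "finite S" "set_mset (content p T) \<subseteq> S"
  shows "(\<Sum>T'\<in>Pow T. h (content p T')) =
    (\<Sum>\<beta> | \<beta> \<subseteq># content p T. of_nat (mbinom S (content p T) \<beta>) * h \<beta>)"
proof -
  have "(\<Sum>T'\<in>Pow T. h (content p T')) =
      (\<Sum>\<beta> | \<beta> \<subseteq># content p T. \<Sum>T' | T' \<in> Pow T \<and> content p T' = \<beta>. h (content p T'))"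
    using assms(1) content_mono
    by (intro sum.group[symmetric]) (auto simp: finite_submultisets)
  also have "\<dots> = (\<Sum>\<beta> | \<beta> \<subseteq># content p T. of_nat (mbinom S (content p T) \<beta>) * h \<beta>)"
  proof (rule sum.cong)
    fix \<beta> assume "\<beta> \<in> {\<beta>. \<beta> \<subseteq># content p T}"
    then have "set_mset \<beta> \<subseteq> S" using assms(3) set_mset_mono by blast
    then have "card {T'. T' \<in> Pow T \<and> content p T' = \<beta>} = mbinom S (content p T) \<beta>"
      using card_subsets_content[of T S \<beta> p] assms by (simp add: mbinom_def)
    then show "(\<Sum>T' | T' \<in> Pow T \<and> content p T' = \<beta>. h (content p T')) =
        of_nat (mbinom S (content p T) \<beta>) * h \<beta>"
      by simp
  qed simp
  finally show ?thesis .
qed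

section \<open>The level recursion for iterated subsets\<close>

text \<open>
  The coefficients for an arbitrary set \<open>T\<close> of slots in place of \<^term>\<open>slots \<gamma>\<close>. Moebius inversion runs over
  the subsets of \<^term>\<open>slots \<gamma>\<close>, and these are in general not of the form \<^term>\<open>slots \<beta>\<close>.
\<close>

definition num_hset :: "nat \<Rightarrow> ('s \<times> nat) set \<Rightarrow> 's hindex \<Rightarrow> nat"
  where "num_hset m T \<kappa> = card {K \<in> hpow m T. profile K = \<kappa>}"

definition num_cov :: "nat \<Rightarrow> ('s \<times> nat) set \<Rightarrow> 's hindex \<Rightarrow> nat"
  where "num_cov m T \<kappa> = card {K \<in> coverings m T. profile K = \<kappa>}"

lemma bij_betw_fset_Pow:
  assumes "finite A"
  shows "bij_betw fset {T. T \<noteq> {||} \<and> fset T \<subseteq> A \<and> P (fset T)} {T. T \<noteq> {} \<and> T \<subseteq> A \<and> P T}"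
proof (rule bij_betw_imageI)
  show "inj_on fset {T. T \<noteq> {||} \<and> fset T \<subseteq> A \<and> P (fset T)}"
    by (auto simp: inj_on_def fset_inject)
  show "fset ` {T. T \<noteq> {||} \<and> fset T \<subseteq> A \<and> P (fset T)} = {T. T \<noteq> {} \<and> T \<subseteq> A \<and> P T}"
  proof (intro equalityI subsetI)
    fix T assume T: "T \<in> {T. T \<noteq> {} \<and> T \<subseteq> A \<and> P T}"
    then have "T = fset (Abs_fset T)"
      using assms by (metis (mono_tags, lifting) Abs_fset_inverse finite_subset mem_Collect_eq)
    then show "T \<in> fset ` {T. T \<noteq> {||} \<and> fset T \<subseteq> A \<and> P (fset T)}"
      using T by (intro image_eqI[of _ _ "Abs_fset T"]) auto
  qed (auto simp flip: bot_fset.rep_eq simp: fset_inject)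
qed

lemma num_hset_MBase:
  assumes "finite T" "finite S" "set_mset \<alpha> \<subseteq> S" "\<alpha> \<noteq> {#}"
  shows "num_hset (Suc 0) T (MBase \<alpha>) = mbinom S (content fst T) \<alpha>"
proof -
  have "{K \<in> hpow (Suc 0) T. profile K = MBase \<alpha>} =
      PBase ` {U. U \<noteq> {||} \<and> fset U \<subseteq> T \<and> content fst (fset U) = \<alpha>}"
    by auto
  then have "num_hset (Suc 0) T (MBase \<alpha>) =
      card {U. U \<noteq> {||} \<and> fset U \<subseteq> T \<and> content fst (fset U) = \<alpha>}"
    by (simp add: num_hset_def card_image inj_on_def)
  also have "\<dots> = card {U. U \<noteq> {} \<and> U \<subseteq> T \<and> content fst U = \<alpha>}"
    by (rule bij_betw_same_card[OF bij_betw_fset_Pow[OF assms(1)]])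
  also have "{U. U \<noteq> {} \<and> U \<subseteq> T \<and> content fst U = \<alpha>} = {U. U \<subseteq> T \<and> content fst U = \<alpha>}"
    using assms(4) by auto
  finally show ?thesis
    using card_subsets_content[of T S \<alpha> fst] assms by (simp add: mbinom_def)
qed

lemma num_hset_MNode:
  assumes "finite T" "\<kappa> \<noteq> {#}"
  shows "num_hset (Suc (Suc r)) T (MNode \<kappa>) =
    (\<Prod>l\<in>set_mset \<kappa>. num_hset (Suc r) T l choose count \<kappa> l)"
proof -
  let ?H = "hpow (Suc r) T"
  have fin: "finite ?H" by (rule finite_hpow[OF assms(1)])
  have "{K \<in> hpow (Suc (Suc r)) T. profile K = MNode \<kappa>} =
      PNode ` {U. U \<noteq> {||} \<and> fset U \<subseteq> ?H \<and> content profile (fset U) = \<kappa>}"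
    by auto
  then have "num_hset (Suc (Suc r)) T (MNode \<kappa>) =
      card {U. U \<noteq> {||} \<and> fset U \<subseteq> ?H \<and> content profile (fset U) = \<kappa>}"
    by (simp add: num_hset_def card_image inj_on_def)
  also have "\<dots> = card {U. U \<noteq> {} \<and> U \<subseteq> ?H \<and> content profile U = \<kappa>}"
    by (rule bij_betw_same_card[OF bij_betw_fset_Pow[OF fin]])
  also have "{U. U \<noteq> {} \<and> U \<subseteq> ?H \<and> content profile U = \<kappa>} =
      {U. U \<subseteq> ?H \<and> content profile U = \<kappa>}"
    using assms(2) by auto
  finally show ?thesis
    using card_subsets_content[of ?H "set_mset \<kappa>" \<kappa> profile] fin
    by (simp add: count_content num_hset_def)
qed

text \<open>
  The base case and the level recursion mention \<open>T\<close> only through its label multiset, so relabelling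
  the slots of \<open>T\<close> as those of \<^term>\<open>content fst T\<close> does not change the count.
\<close>

lemma num_hset_content:
  assumes "\<kappa> \<in> hmulti m S" "finite S" "finite T"
  shows "num_hset m T \<kappa> = Pow_coeff m (content fst T) \<kappa>"
proof -
  have slots: "Pow_coeff m \<gamma> \<kappa> = num_hset m (slots \<gamma>) \<kappa>" for m :: nat and \<gamma> and \<kappa> :: "'a hindex"
    by (simp add: Pow_coeff_def num_hset_def)
  show ?thesis
    using assms(1,2)
  proof (induction m S arbitrary: \<kappa> rule: hmulti.induct)
    case (1 S)
    then show ?case by simp
  next
    case (2 S)
    then show ?case
      using assms(3) by (auto simp: slots num_hset_MBase finite_slots content_slots)
  next
    case (3 r S)
    then obtain \<kappa>' where \<kappa>: "\<kappa> = MNode \<kappa>'" "\<kappa>' \<noteq> {#}" "set_mset \<kappa>' \<subseteq> hmulti (Suc r) S"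
      by auto
    then have "num_hset (Suc r) T l = num_hset (Suc r) (slots (content fst T)) l"
      if "l \<in># \<kappa>'" for l
      using 3 that by (auto simp: slots)
    then show ?case
      using \<kappa> assms(3) by (simp add: slots num_hset_MNode finite_slots)
  qed
qed

section \<open>Leaf supports and Moebius inversion\<close>

lemma hpow_mono: "S \<subseteq> T \<Longrightarrow> hpow m S \<subseteq> hpow m T"
  by (induction m S rule: hpow.induct) fastforce+

lemma hpow_iff_leaf: "K \<in> hpow m S \<Longrightarrow> K \<in> hpow m T \<longleftrightarrow> leaf K \<subseteq> T"
proof (induction m S arbitrary: K rule: hpow.induct)
  case (3 r S)
  then obtain K' where K: "K = PNode K'" "K' \<noteq> {||}" "fset K' \<subseteq> hpow (Suc r) S"
    by auto
  with 3 have "L \<in> hpow (Suc r) T \<longleftrightarrow> leaf L \<subseteq> T" if "L \<in> fset K'" for L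
    using that by blast
  with K show ?case by auto
qed auto

lemma leaf_subset: "K \<in> hpow m S \<Longrightarrow> leaf K \<subseteq> S"
  using hpow_iff_leaf by blast

lemma hpow_empty [simp]: "hpow m {} = {}"
proof (induction m "{} :: 'a set" rule: hpow.induct)
  case 2
  show ?case by (auto simp flip: bot_fset.rep_eq simp: fset_inject)
next
  case (3 r)
  then show ?case by (auto simp flip: bot_fset.rep_eq simp: fset_inject)
qed simp

text \<open>
  Every iterated subset covers exactly one set, its leaf support. So counts and sums over \<^const>\<open>hpow\<close> are
  subset sums of counts and sums over \<^const>\<open>coverings\<close>.
\<close>

lemma hpow_eq_UN_coverings: "hpow m S = (\<Union>T\<in>Pow S. coverings m T)"
proof
  show "hpow m S \<subseteq> (\<Union>T\<in>Pow S. coverings m T)"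
    using hpow_iff_leaf leaf_subset by (fastforce simp: coverings_def)
  show "(\<Union>T\<in>Pow S. coverings m T) \<subseteq> hpow m S"
    using hpow_mono by (fastforce simp: coverings_def)
qed

lemma num_hset_eq_sum_num_cov:
  assumes "finite T"
  shows "num_hset m T \<kappa> = (\<Sum>U\<in>Pow T. num_cov m U \<kappa>)"
proof -
  have "{K \<in> hpow m T. profile K = \<kappa>} = (\<Union>U\<in>Pow T. {K \<in> coverings m U. profile K = \<kappa>})"
    by (auto simp: hpow_eq_UN_coverings)
  moreover have "finite {K \<in> coverings m U. profile K = \<kappa>}" if "U \<in> Pow T" for U
    using that assms finite_hpow[of U m] finite_subset[of U T] by (simp add: coverings_def)
  moreover have "{K \<in> coverings m U. profile K = \<kappa>} \<inter> {K \<in> coverings m U'. profile K = \<kappa>} = {}"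
    if "U \<noteq> U'" for U U'
    using that by (auto simp: coverings_def)
  ultimately show ?thesis
    using assms unfolding num_hset_def num_cov_def
    by (simp add: card_UN_disjoint)
qed

text \<open>
  Stated for finite sets of slots other than \<^term>\<open>slots \<gamma>\<close> too, since its right-hand side exhibits
  the covering count as a function of the label multiset of \<open>T\<close> alone; that is what \<open>num_cov_content\<close> extracts.
\<close>

lemma num_cov_moebius:
  assumes "\<kappa> \<in> hmulti m S" "finite S" "finite T" "set_mset (content fst T) \<subseteq> S"
  shows "int (num_cov m T \<kappa>) =
    (\<Sum>\<beta> | \<beta> \<subseteq># content fst T. (-1) ^ size (content fst T - \<beta>) *
      int (mbinom S (content fst T) \<beta>) * int (Pow_coeff m \<beta> \<kappa>))"
proof -
  let ?\<gamma> = "content fst T"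
  have "int (num_cov m T \<kappa>) = (\<Sum>U\<in>Pow T. (-1) ^ (card T - card U) * int (num_hset m U \<kappa>))"
    using assms(3)
    by (intro inclusion_exclusion_mobius) (simp_all add: num_hset_eq_sum_num_cov)
  also have "\<dots> = (\<Sum>U\<in>Pow T. (-1) ^ (size ?\<gamma> - size (content fst U)) *
      int (Pow_coeff m (content fst U) \<kappa>))"
    using assms(3) by (intro sum.cong) (auto simp: num_hset_content[OF assms(1,2)] dest: finite_subset)
  also have "\<dots> = (\<Sum>\<beta> | \<beta> \<subseteq># ?\<gamma>. int (mbinom S ?\<gamma> \<beta>) *
      ((-1) ^ (size ?\<gamma> - size \<beta>) * int (Pow_coeff m \<beta> \<kappa>)))"
    using assms sum_subsets_content[where S = S and T = T and p = fst and
      h = "\<lambda>\<beta>. (-1) ^ (size ?\<gamma> - size \<beta>) * int (Pow_coeff m \<beta> \<kappa>)"] by simp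
  also have "\<dots> = (\<Sum>\<beta> | \<beta> \<subseteq># ?\<gamma>. (-1) ^ size (?\<gamma> - \<beta>) * int (mbinom S ?\<gamma> \<beta>) * int (Pow_coeff m \<beta> \<kappa>))"
    by (intro sum.cong) (auto simp: size_Diff_submset)
  finally show ?thesis .
qed

lemma num_cov_slots: "num_cov m (slots \<gamma>) \<kappa> = Cov_coeff m \<gamma> \<kappa>"
  by (simp add: Cov_coeff_def num_cov_def)

lemma Cov_coeff_moebius:
  assumes "\<kappa> \<in> hmulti m S" "finite S" "set_mset \<gamma> \<subseteq> S"
  shows "int (Cov_coeff m \<gamma> \<kappa>) =
    (\<Sum>\<beta> | \<beta> \<subseteq># \<gamma>. (-1) ^ size (\<gamma> - \<beta>) * int (mbinom S \<gamma> \<beta>) * int (Pow_coeff m \<beta> \<kappa>))"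
  using num_cov_moebius[OF assms(1,2), of "slots \<gamma>"] assms(3)
  by (simp add: num_cov_slots content_slots finite_slots)

lemma num_cov_content:
  assumes "\<kappa> \<in> hmulti m S" "finite S" "finite T" "set_mset (content fst T) \<subseteq> S"
  shows "num_cov m T \<kappa> = Cov_coeff m (content fst T) \<kappa>"
  using num_cov_moebius[OF assms] Cov_coeff_moebius[OF assms(1,2,4)] by simp

text \<open>
  The inverse relation is the decomposition of the iterated subsets of
  \<^term>\<open>slots \<gamma>\<close> by leaf support, once covering counts are known to depend only on label multisets.
\<close>

lemma Pow_coeff_eq_sum_Cov_coeff:
  assumes "\<kappa> \<in> hmulti m S" "finite S" "set_mset \<gamma> \<subseteq> S"
  shows "Pow_coeff m \<gamma> \<kappa> = (\<Sum>\<beta> | \<beta> \<subseteq># \<gamma>. mbinom S \<gamma> \<beta> * Cov_coeff m \<beta> \<kappa>)"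
proof -
  have "Pow_coeff m \<gamma> \<kappa> = num_hset m (slots \<gamma>) \<kappa>"
    by (simp add: Pow_coeff_def num_hset_def)
  also have "\<dots> = (\<Sum>U\<in>Pow (slots \<gamma>). num_cov m U \<kappa>)"
    by (rule num_hset_eq_sum_num_cov[OF finite_slots])
  also have "\<dots> = (\<Sum>U\<in>Pow (slots \<gamma>). Cov_coeff m (content fst U) \<kappa>)"
  proof (rule sum.cong)
    fix U assume "U \<in> Pow (slots \<gamma>)"
    then have "finite U" "content fst U \<subseteq># \<gamma>"
      using content_mono[of U "slots \<gamma>" fst] finite_slots[of \<gamma>]
      by (auto simp: content_slots dest: finite_subset)
    then show "num_cov m U \<kappa> = Cov_coeff m (content fst U) \<kappa>"
      using assms set_mset_mono by (intro num_cov_content) blast+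
  qed simp
  also have "\<dots> = (\<Sum>\<beta> | \<beta> \<subseteq># \<gamma>. mbinom S \<gamma> \<beta> * Cov_coeff m \<beta> \<kappa>)"
    using sum_subsets_content[of "slots \<gamma>" S fst "\<lambda>\<beta>. Cov_coeff m \<beta> \<kappa>"] assms
    by (simp add: content_slots finite_slots)
  finally show ?thesis .
qed

section \<open>Explicit formulas for the coefficients\<close>

lemma Pow_coeff_MBase:
  assumes "MBase \<alpha> \<in> hmulti 1 S" "finite S"
  shows "Pow_coeff 1 \<gamma> (MBase \<alpha>) = mbinom S \<gamma> \<alpha>"
  using assms num_hset_MBase[of "slots \<gamma>" S \<alpha>]
  by (simp add: finite_slots content_slots Pow_coeff_def num_hset_def)

text \<open>
  The only covering of level one is the full slot set, and its profile is \<open>\<gamma>\<close>.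
\<close>

lemma Cov_coeff_MBase:
  assumes "MBase \<alpha> \<in> hmulti 1 S"
  shows "Cov_coeff 1 \<gamma> (MBase \<alpha>) = (if \<gamma> = \<alpha> then 1 else 0)"
proof -
  have \<alpha>: "\<alpha> \<noteq> {#}" using assms by auto
  obtain T where T: "fset T = slots \<gamma>"
    using Abs_fset_inverse[of "slots \<gamma>"] finite_slots[of \<gamma>] by blast
  then have eq: "fset U = slots \<gamma> \<longleftrightarrow> U = T" for U by (metis fset_inject)
  have content: "content fst (fset T) = \<gamma>" by (simp add: T content_slots)
  have "{K \<in> coverings 1 (slots \<gamma>). profile K = MBase \<alpha>} =
      {K. K = PBase T \<and> T \<noteq> {||} \<and> profile (PBase T) = MBase \<alpha>}"
  proof (rule Collect_cong)
    fix K
    show "K \<in> coverings 1 (slots \<gamma>) \<and> profile K = MBase \<alpha> \<longleftrightarrow>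
        K = PBase T \<and> T \<noteq> {||} \<and> profile (PBase T) = MBase \<alpha>"
      by (cases K) (use eq T in \<open>auto simp: coverings_def\<close>)
  qed
  also have "\<dots> = (if \<gamma> = \<alpha> then {PBase T} else {})"
    using \<alpha> content by auto
  finally have "{K \<in> coverings 1 (slots \<gamma>). profile K = MBase \<alpha>} =
      (if \<gamma> = \<alpha> then {PBase T} else {})" .
  then show ?thesis by (simp add: Cov_coeff_def)
qed

lemma of_nat_choose_falling: "(of_nat (n choose k) :: rat) = falling (of_nat n) k / fact k"
  by (simp only: binomial_gbinomial gbinomial_prod_rev falling_def atLeast0LessThan)

lemma Pow_coeff_MNode:
  assumes "\<kappa> \<noteq> {#}"
  shows "(of_nat (Pow_coeff (Suc (Suc r)) \<gamma> (MNode \<kappa>)) :: rat) =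
    1 / of_nat (mfact \<kappa>) *
      (\<Prod>l\<in>set_mset \<kappa>. falling (of_nat (Pow_coeff (Suc r) \<gamma> l)) (count \<kappa> l))"
proof -
  have "Pow_coeff (Suc (Suc r)) \<gamma> (MNode \<kappa>) =
      (\<Prod>l\<in>set_mset \<kappa>. Pow_coeff (Suc r) \<gamma> l choose count \<kappa> l)"
    using num_hset_MNode[OF finite_slots assms] by (simp add: Pow_coeff_def num_hset_def)
  then show ?thesis
    by (simp add: of_nat_choose_falling mfact_def prod_dividef)
qed

lemma Cov_coeff_MNode:
  assumes "MNode \<kappa> \<in> hmulti (Suc (Suc r)) S" "finite S" "set_mset \<gamma> \<subseteq> S"
  shows "(of_nat (Cov_coeff (Suc (Suc r)) \<gamma> (MNode \<kappa>)) :: rat) =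
    (\<Sum>\<beta> | \<beta> \<subseteq># \<gamma>. (-1) ^ size (\<gamma> - \<beta>) * of_nat (mbinom S \<gamma> \<beta>) *
       (1 / of_nat (mfact \<kappa>) *
         (\<Prod>l\<in>set_mset \<kappa>.
            falling (\<Sum>\<alpha> | \<alpha> \<subseteq># \<beta>. of_nat (mbinom S \<beta> \<alpha>) * of_nat (Cov_coeff (Suc r) \<alpha> l))
              (count \<kappa> l))))"
proof -
  have \<kappa>: "\<kappa> \<noteq> {#}" "set_mset \<kappa> \<subseteq> hmulti (Suc r) S" using assms(1) by auto
  have "(of_nat (Cov_coeff (Suc (Suc r)) \<gamma> (MNode \<kappa>)) :: rat) =
      of_int (int (Cov_coeff (Suc (Suc r)) \<gamma> (MNode \<kappa>)))"
    by simp
  also have "\<dots> = (\<Sum>\<beta> | \<beta> \<subseteq># \<gamma>. (-1) ^ size (\<gamma> - \<beta>) * of_nat (mbinom S \<gamma> \<beta>) *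
      of_nat (Pow_coeff (Suc (Suc r)) \<beta> (MNode \<kappa>)))"
    unfolding Cov_coeff_moebius[OF assms] by simp
  also have "\<dots> = (\<Sum>\<beta> | \<beta> \<subseteq># \<gamma>. (-1) ^ size (\<gamma> - \<beta>) * of_nat (mbinom S \<gamma> \<beta>) *
       (1 / of_nat (mfact \<kappa>) *
         (\<Prod>l\<in>set_mset \<kappa>.
            falling (\<Sum>\<alpha> | \<alpha> \<subseteq># \<beta>. of_nat (mbinom S \<beta> \<alpha>) * of_nat (Cov_coeff (Suc r) \<alpha> l))
              (count \<kappa> l))))"
  proof (rule sum.cong)
    fix \<beta> assume "\<beta> \<in> {\<beta>. \<beta> \<subseteq># \<gamma>}"
    then have "set_mset \<beta> \<subseteq> S" using assms(3) set_mset_mono by blast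
    then have "of_nat (Pow_coeff (Suc r) \<beta> l) =
        (\<Sum>\<alpha> | \<alpha> \<subseteq># \<beta>. (of_nat (mbinom S \<beta> \<alpha>) :: rat) * of_nat (Cov_coeff (Suc r) \<alpha> l))"
      if "l \<in># \<kappa>" for l
      using Pow_coeff_eq_sum_Cov_coeff[of l "Suc r" S \<beta>] that \<kappa>(2) assms(2) by auto
    then show "(-1) ^ size (\<gamma> - \<beta>) * of_nat (mbinom S \<gamma> \<beta>) *
        of_nat (Pow_coeff (Suc (Suc r)) \<beta> (MNode \<kappa>)) =
      (-1) ^ size (\<gamma> - \<beta>) * of_nat (mbinom S \<gamma> \<beta>) *
       (1 / of_nat (mfact \<kappa>) *
         (\<Prod>l\<in>set_mset \<kappa>.
            falling (\<Sum>\<alpha> | \<alpha> \<subseteq># \<beta>. of_nat (mbinom S \<beta> \<alpha>) * of_nat (Cov_coeff (Suc r) \<alpha> l))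
              (count \<kappa> l)))"
      by (simp add: Pow_coeff_MNode[OF \<kappa>(1)])
  qed simp
  finally show ?thesis .
qed

section \<open>Subset differences in an abelian group\<close>

text \<open>
  The Moebius transform of a function of finite sets. Forward differences are the instance
  \<open>F T = h (a + \<Sum>\<^sub>T w)\<close>; an arbitrary \<open>F\<close> is what the induction in \<open>finsum_subset_diff\<close> needs, which passes
  from \<open>F\<close> to \<open>\<lambda>T. F (insert j T)\<close>.
\<close>

definition subset_diff :: "('b, 'n) ring_scheme \<Rightarrow> ('i set \<Rightarrow> 'b) \<Rightarrow> 'i set \<Rightarrow> 'b"
  where "subset_diff G F I =
    (\<Oplus>\<^bsub>G\<^esub>T\<in>Pow I. [((-1) ^ (card I - card T) :: int)] \<cdot>\<^bsub>G\<^esub> F T)"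

lemma fwd_diff_eq_subset_diff:
  "fwd_diff A B h a I w = subset_diff B (\<lambda>T. h (a \<oplus>\<^bsub>A\<^esub> finsum A w T)) I"
  by (simp add: fwd_diff_def subset_diff_def)

context abelian_group
begin

lemma finsum_Pow_insert:
  assumes "finite I" "j \<notin> I" "\<And>T. T \<subseteq> insert j I \<Longrightarrow> F T \<in> carrier G"
  shows "(\<Oplus>T\<in>Pow (insert j I). F T) = (\<Oplus>T\<in>Pow I. F T) \<oplus> (\<Oplus>T\<in>Pow I. F (insert j T))"
proof -
  have inj: "inj_on (insert j) (Pow I)"
  proof (rule inj_onI)
    fix T U assume "T \<in> Pow I" "U \<in> Pow I" and eq: "insert j T = insert j U"
    then have "j \<notin> T" "j \<notin> U" using assms(2) by auto
    with eq show "T = U" by (simp add: insert_ident)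
  qed
  have "(\<Oplus>T\<in>Pow (insert j I). F T) = (\<Oplus>T\<in>Pow I. F T) \<oplus> (\<Oplus>T\<in>insert j ` Pow I. F T)"
    unfolding Pow_insert using assms by (intro finsum_Un_disjoint) (auto intro!: assms(3))
  also have "(\<Oplus>T\<in>insert j ` Pow I. F T) = (\<Oplus>T\<in>Pow I. F (insert j T))"
    using inj by (intro finsum_reindex) (auto intro!: assms(3))
  finally show ?thesis .
qed

lemma subset_diff_closed:
  assumes "\<And>T. T \<subseteq> I \<Longrightarrow> F T \<in> carrier G"
  shows "subset_diff G F I \<in> carrier G"
  unfolding subset_diff_def using assms by (intro finsum_closed) auto

text \<open>
  The value at \<open>insert j I\<close> is the transform of \<open>\<lambda>T. F (insert j T)\<close> at \<open>I\<close> minus that of \<open>F\<close> at \<open>I\<close>, written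
  without subtraction so that it can be summed termwise. Among the subsets of \<open>insert j I\<close>, those
  without \<open>j\<close> contribute the negative of \<open>subset_diff G F I\<close>, since the exponent of the
  sign grows by one.
\<close>

lemma subset_diff_insert:
  assumes "finite I" "j \<notin> I" "\<And>T. T \<subseteq> insert j I \<Longrightarrow> F T \<in> carrier G"
  shows "subset_diff G F I \<oplus> subset_diff G F (insert j I) = subset_diff G (\<lambda>T. F (insert j T)) I"
proof -
  let ?s = "\<lambda>T. (-1) ^ (card I - card T) :: int"
  let ?P = "\<Oplus>T\<in>Pow I. [?s T] \<cdot> F T" and ?N = "\<Oplus>T\<in>Pow I. [(- ?s T)] \<cdot> F T"
  have F: "F T \<in> carrier G" "F (insert j T) \<in> carrier G" if "T \<in> Pow I" for T
    using that by (auto intro!: assms(3))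
  have "subset_diff G F (insert j I) =
      (\<Oplus>T\<in>Pow I. [((-1) ^ (card (insert j I) - card T) :: int)] \<cdot> F T) \<oplus>
      (\<Oplus>T\<in>Pow I. [((-1) ^ (card (insert j I) - card (insert j T)) :: int)] \<cdot> F (insert j T))"
    unfolding subset_diff_def using assms by (intro finsum_Pow_insert) auto
  also have "(\<Oplus>T\<in>Pow I. [((-1) ^ (card (insert j I) - card T) :: int)] \<cdot> F T) = ?N"
  proof (rule finsum_cong')
    fix T assume T: "T \<in> Pow I"
    then have "card T \<le> card I" using assms(1) by (auto intro: card_mono)
    then show "[((-1) ^ (card (insert j I) - card T) :: int)] \<cdot> F T = [(- ?s T)] \<cdot> F T"
      using assms(1,2) by (simp add: Suc_diff_le)
  qed (use F in auto)
  also have "(\<Oplus>T\<in>Pow I. [((-1) ^ (card (insert j I) - card (insert j T)) :: int)] \<cdot> F (insert j T)) =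
      subset_diff G (\<lambda>T. F (insert j T)) I"
    unfolding subset_diff_def
  proof (rule finsum_cong')
    fix T assume T: "T \<in> Pow I"
    then have "finite T" "j \<notin> T" using assms(1,2) by (auto intro: finite_subset)
    then show "[((-1) ^ (card (insert j I) - card (insert j T)) :: int)] \<cdot> F (insert j T) =
        [?s T] \<cdot> F (insert j T)"
      using assms(1,2) by simp
  qed (use F in auto)
  finally have ins: "subset_diff G F (insert j I) = ?N \<oplus> subset_diff G (\<lambda>T. F (insert j T)) I" .
  have "?P \<oplus> ?N = (\<Oplus>T\<in>Pow I. [?s T] \<cdot> F T \<oplus> [(- ?s T)] \<cdot> F T)"
    using F by (intro finsum_addf[symmetric]) auto
  also have "\<dots> = (\<Oplus>T\<in>Pow I. \<zero>)"
    using F by (intro finsum_cong') (auto simp: add.int_pow_neg r_neg)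
  finally have cancel: "?P \<oplus> ?N = \<zero>" by simp
  have closed: "?P \<in> carrier G" "?N \<in> carrier G"
    "subset_diff G (\<lambda>T. F (insert j T)) I \<in> carrier G"
    using F by (auto intro!: finsum_closed subset_diff_closed)
  have "subset_diff G F I \<oplus> subset_diff G F (insert j I) =
      ?P \<oplus> (?N \<oplus> subset_diff G (\<lambda>T. F (insert j T)) I)"
    unfolding ins by (simp add: subset_diff_def)
  also have "\<dots> = subset_diff G (\<lambda>T. F (insert j T)) I"
    using closed cancel by (simp flip: a_assoc)
  finally show ?thesis .
qed

text \<open>
  Induction on \<open>I\<close>: pairing \<open>T\<close> with \<open>insert j T\<close>, the recursion turns the subset sum of the
  transform of \<open>F\<close> over \<open>insert j I\<close> into that of the transform of \<open>\<lambda>T. F (insert j T)\<close> over \<open>I\<close>.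
\<close>

lemma finsum_subset_diff:
  assumes "finite I" "\<And>T. T \<subseteq> I \<Longrightarrow> F T \<in> carrier G"
  shows "(\<Oplus>T\<in>Pow I. subset_diff G F T) = F I"
  using assms
proof (induction I arbitrary: F rule: finite_induct)
  case empty
  then show ?case by (simp add: subset_diff_def)
next
  case (insert j I)
  have closed: "subset_diff G F T \<in> carrier G" if "T \<subseteq> insert j I" for T
    using that insert.prems by (intro subset_diff_closed) auto
  have "(\<Oplus>T\<in>Pow (insert j I). subset_diff G F T) =
      (\<Oplus>T\<in>Pow I. subset_diff G F T) \<oplus> (\<Oplus>T\<in>Pow I. subset_diff G F (insert j T))"
    using insert.hyps closed by (intro finsum_Pow_insert)
  also have "\<dots> = (\<Oplus>T\<in>Pow I. subset_diff G F T \<oplus> subset_diff G F (insert j T))"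
    using closed by (intro finsum_addf[symmetric]) (auto intro!: closed)
  also have "\<dots> = (\<Oplus>T\<in>Pow I. subset_diff G (\<lambda>T. F (insert j T)) T)"
  proof (rule finsum_cong')
    fix T assume "T \<in> Pow I"
    then show "subset_diff G F T \<oplus> subset_diff G F (insert j T) =
        subset_diff G (\<lambda>T. F (insert j T)) T"
      using insert.hyps by (intro subset_diff_insert) (auto intro!: insert.prems dest: finite_subset)
  qed (auto intro!: subset_diff_closed insert.prems)
  also have "\<dots> = F (insert j I)"
    by (rule insert.IH) (auto intro!: insert.prems)
  finally show ?case .
qed

text \<open>
  A function of finite sets is determined by its subset sums: by induction the values on
  proper subsets agree, and cancelling them leaves the value on the whole set.
\<close>

lemma eq_if_finsum_Pow_eq:
  assumes "finite I"
    and "\<And>T. T \<subseteq> I \<Longrightarrow> g T \<in> carrier G" "\<And>T. T \<subseteq> I \<Longrightarrow> g' T \<in> carrier G"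
    and "\<And>T. T \<subseteq> I \<Longrightarrow> (\<Oplus>U\<in>Pow T. g U) = (\<Oplus>U\<in>Pow T. g' U)"
  shows "g I = g' I"
  using assms
proof (induction I rule: finite_psubset_induct)
  case (psubset I)
  have split: "(\<Oplus>U\<in>Pow I. k U) = k I \<oplus> (\<Oplus>U\<in>Pow I - {I}. k U)"
    if "\<And>T. T \<subseteq> I \<Longrightarrow> k T \<in> carrier G" for k
  proof -
    have "(\<Oplus>U\<in>insert I (Pow I - {I}). k U) = k I \<oplus> (\<Oplus>U\<in>Pow I - {I}. k U)"
      using that psubset.hyps by (intro finsum_insert) auto
    then show ?thesis by (simp add: insert_absorb)
  qed
  have "(\<Oplus>U\<in>Pow I - {I}. g U) = (\<Oplus>U\<in>Pow I - {I}. g' U)"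
  proof (rule finsum_cong')
    fix T assume "T \<in> Pow I - {I}"
    then have "T \<subset> I" by auto
    then show "g T = g' T" by (rule psubset.IH) (use \<open>T \<subset> I\<close> psubset.prems in auto)
  qed (use psubset.prems in auto)
  moreover have "(\<Oplus>U\<in>Pow I - {I}. g' U) \<in> carrier G"
    using psubset.prems by (intro finsum_closed) auto
  ultimately show ?case
    using psubset.prems split[of g] split[of g'] by auto
qed

lemma finsum_by_value:
  assumes "finite A" "\<And>a. a \<in> A \<Longrightarrow> v (p a) \<in> carrier G"
  shows "(\<Oplus>a\<in>A. v (p a)) = (\<Oplus>b\<in>p ` A. [card {a \<in> A. p a = b}] \<cdot> v b)"
proof -
  have "A = (\<Union>b\<in>p ` A. {a \<in> A. p a = b})" by auto
  then have "(\<Oplus>a\<in>A. v (p a)) = (\<Oplus>a\<in>(\<Union>b\<in>p ` A. {a \<in> A. p a = b}). v (p a))"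
    by simp
  also have "\<dots> = (\<Oplus>b\<in>p ` A. \<Oplus>a\<in>{a \<in> A. p a = b}. v (p a))"
    using assms by (intro add.finprod_UN_disjoint) (auto simp: pairwise_def disjnt_def)
  also have "\<dots> = (\<Oplus>b\<in>p ` A. [card {a \<in> A. p a = b}] \<cdot> v b)"
  proof (rule finsum_cong')
    fix b assume "b \<in> p ` A"
    then have b: "v b \<in> carrier G" using assms(2) by auto
    then have "(\<Oplus>a\<in>{a \<in> A. p a = b}. v (p a)) = (\<Oplus>a\<in>{a \<in> A. p a = b}. v b)"
      by (intro finsum_cong') auto
    also have "\<dots> = [card {a \<in> A. p a = b}] \<cdot> v b"
      using b by (rule add.finprod_const)
    finally show "(\<Oplus>a\<in>{a \<in> A. p a = b}. v (p a)) = [card {a \<in> A. p a = b}] \<cdot> v b" .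
  qed (use assms in auto)
  finally show ?thesis .
qed

end

section \<open>Forward differences of one map\<close>

text \<open>
  A map \<open>h\<close> of underlying sets with a base point \<open>a\<close>. It serves both for a single map of a chain and
  for the whole composite.
\<close>

locale abelian_group_map = A: abelian_group A + B: abelian_group B
  for A :: "('a, 'm) ring_scheme" and B :: "('b, 'n) ring_scheme" +
  fixes h :: "'a \<Rightarrow> 'b" and a :: 'a
  assumes h_closed: "h \<in> carrier A \<rightarrow> carrier B" and a_closed: "a \<in> carrier A"
begin

lemma base_closed: "h a \<in> carrier B"
  using h_closed a_closed by auto

lemma summand_closed:
  "w \<in> I \<rightarrow> carrier A \<Longrightarrow> T \<subseteq> I \<Longrightarrow> h (a \<oplus>\<^bsub>A\<^esub> finsum A w T) \<in> carrier B"
  using h_closed a_closed A.finsum_closed[of w T] by (auto simp: Pi_iff subset_iff)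

lemma fwd_diff_closed:
  "w \<in> I \<rightarrow> carrier A \<Longrightarrow> fwd_diff A B h a I w \<in> carrier B"
  unfolding fwd_diff_eq_subset_diff using summand_closed by (intro B.subset_diff_closed)

lemma fwd_diff_empty: "fwd_diff A B h a {} w = h a"
  using base_closed a_closed by (simp add: fwd_diff_def)

lemma finsum_fwd_diff:
  assumes "finite I" "w \<in> I \<rightarrow> carrier A"
  shows "(\<Oplus>\<^bsub>B\<^esub>T\<in>Pow I. fwd_diff A B h a T w) = h (a \<oplus>\<^bsub>A\<^esub> finsum A w I)"
  unfolding fwd_diff_eq_subset_diff
  using assms summand_closed by (intro B.finsum_subset_diff)

text \<open>
  The form that can be iterated: the result is again a base point plus a sum of directions. The
  nonempty subsets are indexed by finite sets of type \<open>fset\<close>, to match the constructors of iterated subsets.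
\<close>

lemma fwd_diff_expansion:
  assumes "finite I" "w \<in> I \<rightarrow> carrier A"
  shows "h (a \<oplus>\<^bsub>A\<^esub> finsum A w I) =
    h a \<oplus>\<^bsub>B\<^esub> (\<Oplus>\<^bsub>B\<^esub>T\<in>{T. T \<noteq> {||} \<and> fset T \<subseteq> I}. fwd_diff A B h a (fset T) w)"
proof -
  have closed: "fwd_diff A B h a T w \<in> carrier B" if "T \<subseteq> I" for T
    using that assms(2) by (intro fwd_diff_closed) auto
  have bij: "bij_betw fset {T. T \<noteq> {||} \<and> fset T \<subseteq> I} (Pow I - {{}})"
    using bij_betw_fset_Pow[OF assms(1), of "\<lambda>_. True"]
    by (simp add: Pow_def set_diff_eq conj_commute)
  have "h (a \<oplus>\<^bsub>A\<^esub> finsum A w I) = (\<Oplus>\<^bsub>B\<^esub>T\<in>insert {} (Pow I - {{}}). fwd_diff A B h a T w)"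
    using finsum_fwd_diff[OF assms] by (simp add: insert_absorb)
  also have "\<dots> = h a \<oplus>\<^bsub>B\<^esub> (\<Oplus>\<^bsub>B\<^esub>T\<in>Pow I - {{}}. fwd_diff A B h a T w)"
    using assms(1) closed by (subst B.finsum_insert) (auto simp: fwd_diff_empty base_closed)
  also have "(\<Oplus>\<^bsub>B\<^esub>T\<in>Pow I - {{}}. fwd_diff A B h a T w) =
      (\<Oplus>\<^bsub>B\<^esub>T\<in>{T. T \<noteq> {||} \<and> fset T \<subseteq> I}. fwd_diff A B h a (fset T) w)"
    using B.finsum_reindex[of "\<lambda>T. fwd_diff A B h a T w" fset "{T. T \<noteq> {||} \<and> fset T \<subseteq> I}"]
      bij closed
    by (simp add: bij_betw_def Pi_iff)
  finally show ?thesis .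
qed

lemma fwd_diff_reindex:
  assumes "bij_betw b I J" "w \<in> I \<rightarrow> carrier A" "\<And>i. i \<in> I \<Longrightarrow> w' (b i) = w i"
  shows "fwd_diff A B h a I w = fwd_diff A B h a J w'"
proof -
  have inj: "inj_on b I" and J: "J = b ` I" using assms(1) by (auto simp: bij_betw_def)
  have card: "card (b ` T) = card T" if "T \<subseteq> I" for T
    using inj that by (intro card_image) (rule inj_on_subset)
  have w': "w' \<in> J \<rightarrow> carrier A" using assms(2,3) by (auto simp: J)
  have sums: "finsum A w' (b ` T) = finsum A w T" if "T \<subseteq> I" for T
  proof -
    have "finsum A w' (b ` T) = (\<Oplus>\<^bsub>A\<^esub>i\<in>T. w' (b i))"
      using that w' inj by (intro A.finsum_reindex) (auto simp: J intro: inj_on_subset)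
    also have "\<dots> = finsum A w T"
      using that assms(2,3) by (intro A.finsum_cong') auto
    finally show ?thesis .
  qed
  have "fwd_diff A B h a J w' =
      (\<Oplus>\<^bsub>B\<^esub>T\<in>image b ` Pow I. [((-1) ^ (card J - card T) :: int)] \<cdot>\<^bsub>B\<^esub> h (a \<oplus>\<^bsub>A\<^esub> finsum A w' T))"
    by (simp add: fwd_diff_def J image_Pow_surj)
  also have "\<dots> = (\<Oplus>\<^bsub>B\<^esub>T\<in>Pow I.
      [((-1) ^ (card J - card (b ` T)) :: int)] \<cdot>\<^bsub>B\<^esub> h (a \<oplus>\<^bsub>A\<^esub> finsum A w' (b ` T)))"
    using inj summand_closed[OF w'] by (intro B.finsum_reindex) (auto simp: J inj_on_image_Pow image_mono)
  also have "\<dots> = fwd_diff A B h a I w"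
    unfolding fwd_diff_def using summand_closed[OF assms(2)] card[of I]
    by (intro B.finsum_cong') (auto simp: card sums J)
  finally show ?thesis by simp
qed

end

text \<open>
  Elements with equal labels are numbered consecutively, a newly added element receiving the next
  free number for its label.
\<close>

lemma bij_betw_slots_content:
  assumes "finite I"
  shows "\<exists>b. bij_betw b I (slots (content p I)) \<and> (\<forall>i\<in>I. fst (b i) = p i)"
  using assms
proof (induction I rule: finite_induct)
  case empty
  show ?case by (auto simp: slots_def bij_betw_def)
next
  case (insert j I)
  then obtain b where b: "bij_betw b I (slots (content p I))" "\<forall>i\<in>I. fst (b i) = p i"
    by blast
  let ?new = "(p j, Suc (count (content p I) (p j)))"
  have "slots (content p (insert j I)) = insert ?new (slots (content p I))"
    using insert.hyps by (auto simp: slots_def le_Suc_eq split: if_splits)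
  moreover have "?new \<notin> slots (content p I)" by (simp add: slots_def)
  moreover have "bij_betw (b(j := ?new)) I (slots (content p I))"
    using b(1) insert.hyps by (subst bij_betw_cong[of _ _ b]) auto
  ultimately have "bij_betw (b(j := ?new)) (insert j I) (slots (content p (insert j I)))"
    using insert.hyps notIn_Un_bij_betw[of j I "b(j := ?new)" "slots (content p I)"] by simp
  moreover have "\<forall>i\<in>insert j I. fst ((b(j := ?new)) i) = p i" using b(2) by auto
  ultimately show ?case by blast
qed

section \<open>Iterated increments along a chain of maps\<close>

locale map_chain =
  fixes X :: "nat \<Rightarrow> ('a, 'm) ring_scheme" and f :: "nat \<Rightarrow> 'a \<Rightarrow> 'a" and m :: nat and x :: 'a
  assumes groups: "i \<le> m \<Longrightarrow> abelian_group (X i)"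
    and maps: "1 \<le> i \<Longrightarrow> i \<le> m \<Longrightarrow> f i \<in> carrier (X (i - 1)) \<rightarrow> carrier (X i)"
    and x_closed: "x \<in> carrier (X 0)"
begin

lemma iter_map_closed:
  "y \<in> carrier (X 0) \<Longrightarrow> r \<le> m \<Longrightarrow> iter_map f r y \<in> carrier (X r)"
proof (induction r)
  case (Suc r)
  then show ?case using maps[of "Suc r"] by auto
qed simp

lemma map_step:
  assumes "Suc r \<le> m"
  shows "abelian_group_map (X r) (X (Suc r)) (f (Suc r)) (iter_map f r x)"
  using assms groups maps[of "Suc r"] iter_map_closed[OF x_closed, of r]
  by (auto intro!: abelian_group_map.intro abelian_group_map_axioms.intro)

lemma incr_set_closed:
  assumes "K \<in> hpow r S" "r \<le> m" "u \<in> S \<rightarrow> carrier (X 0)"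
  shows "incr_set X f x u r K \<in> carrier (X r)"
  using assms
proof (induction r S arbitrary: K rule: hpow.induct)
  case (2 S)
  interpret abelian_group_map "X 0" "X 1" "f 1" x
    using map_step[of 0] 2 by simp
  from 2 obtain T where "K = PBase T" "fset T \<subseteq> S" by auto
  then show ?case using 2 fwd_diff_closed[of u "fset T"] by auto
next
  case (3 r S)
  interpret abelian_group_map "X (Suc r)" "X (Suc (Suc r))" "f (Suc (Suc r))" "iter_map f (Suc r) x"
    using map_step[of "Suc r"] 3 by simp
  from 3 obtain K' where K: "K = PNode K'" "fset K' \<subseteq> hpow (Suc r) S" by auto
  then have "incr_set X f x u (Suc r) L \<in> carrier (X (Suc r))" if "L \<in> fset K'" for L
    using 3 that by auto
  then show ?case unfolding K incr_set.simps by (intro fwd_diff_closed) auto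
qed simp

text \<open>
  At level \<open>r + 1\<close> the induction hypothesis presents the argument of \<^term>\<open>f (Suc r)\<close> as a base
  point plus the level-\<open>r\<close> increments; the expansion for one map then produces their nonempty
  subsets, which are the elements of the next level.
\<close>

lemma iter_map_expansion:
  assumes "1 \<le> r" "r \<le> m" "finite S" "u \<in> S \<rightarrow> carrier (X 0)"
  shows "iter_map f r (x \<oplus>\<^bsub>X 0\<^esub> finsum (X 0) u S) =
    iter_map f r x \<oplus>\<^bsub>X r\<^esub> (\<Oplus>\<^bsub>X r\<^esub>K\<in>hpow r S. incr_set X f x u r K)"
  using assms
proof (induction r S rule: hpow.induct)
  case (2 S)
  interpret abelian_group_map "X 0" "X 1" "f 1" x
    using map_step[of 0] 2 by simp
  let ?I = "{T. T \<noteq> {||} \<and> fset T \<subseteq> S}"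
  have hpow: "hpow (Suc 0) S = PBase ` ?I" by auto
  have "(\<Oplus>\<^bsub>X 1\<^esub>K\<in>hpow (Suc 0) S. incr_set X f x u (Suc 0) K) =
      (\<Oplus>\<^bsub>X 1\<^esub>T\<in>?I. incr_set X f x u (Suc 0) (PBase T))"
    unfolding hpow using 2 incr_set_closed[of _ "Suc 0" S u]
    by (intro B.finsum_reindex) (auto simp: inj_on_def)
  then show ?case
    using fwd_diff_expansion[OF 2(3,4)] by simp
next
  case (3 r S)
  interpret abelian_group_map "X (Suc r)" "X (Suc (Suc r))" "f (Suc (Suc r))" "iter_map f (Suc r) x"
    using map_step[of "Suc r"] 3 by simp
  let ?w = "incr_set X f x u (Suc r)"
  let ?I = "{K. K \<noteq> {||} \<and> fset K \<subseteq> hpow (Suc r) S}"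
  have hpow: "hpow (Suc (Suc r)) S = PNode ` ?I" by auto
  have w: "?w \<in> hpow (Suc r) S \<rightarrow> carrier (X (Suc r))"
    using 3 incr_set_closed[of _ "Suc r" S u] by auto
  have "(\<Oplus>\<^bsub>X (Suc (Suc r))\<^esub>K\<in>hpow (Suc (Suc r)) S. incr_set X f x u (Suc (Suc r)) K) =
      (\<Oplus>\<^bsub>X (Suc (Suc r))\<^esub>K\<in>?I. incr_set X f x u (Suc (Suc r)) (PNode K))"
    unfolding hpow using 3 incr_set_closed[of _ "Suc (Suc r)" S u]
    by (intro B.finsum_reindex) (auto simp: inj_on_def)
  then show ?case
    using 3 fwd_diff_expansion[OF finite_hpow[OF 3(4)] w] by simp
qed simp

text \<open>
  Both sides, as functions of \<open>S\<close>, have the subset sums \<open>iter_map f m (x + \<Sum>\<^sub>T u)\<close>, so they agree. For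
  this the right-hand side must be given the value \<open>iter_map f m x\<close> at \<open>{}\<close>, where it has no covering
  to sum over; hence the auxiliary \<open>g\<close> and the restriction to nonempty \<open>S\<close>.
\<close>

lemma fwd_diff_iter_map:
  assumes "1 \<le> m" "finite S" "u \<in> S \<rightarrow> carrier (X 0)" "S \<noteq> {}"
  shows "fwd_diff (X 0) (X m) (iter_map f m) x S u =
    (\<Oplus>\<^bsub>X m\<^esub>K\<in>coverings m S. incr_set X f x u m K)"
proof -
  \<comment> \<open>The composite counts as one map here; its inner structure enters through \<open>iter_map_expansion\<close>.\<close>
  interpret abelian_group_map "X 0" "X m" "iter_map f m" x
    using groups iter_map_closed x_closed
    by (auto intro!: abelian_group_map.intro abelian_group_map_axioms.intro)
  let ?\<Delta> = "incr_set X f x u m"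
  define g where "g T = (if T = {} then iter_map f m x else \<Oplus>\<^bsub>X m\<^esub>K\<in>coverings m T. ?\<Delta> K)" for T
  have z: "iter_map f m x \<in> carrier (X m)"
    using iter_map_closed x_closed by simp
  have empty: "coverings m {} = {}" by (simp add: coverings_def)
  have \<Delta>: "?\<Delta> K \<in> carrier (X m)" if "K \<in> coverings m T" "T \<subseteq> S" for K T
    using that assms(3) by (intro incr_set_closed[of _ _ T]) (auto simp: coverings_def)
  have sum_closed: "(\<Oplus>\<^bsub>X m\<^esub>K\<in>coverings m T. ?\<Delta> K) \<in> carrier (X m)" if "T \<subseteq> S" for T
    using that \<Delta> by (intro B.finsum_closed) auto
  have g_closed: "g T \<in> carrier (X m)" if "T \<subseteq> S" for T
    using that z sum_closed by (simp add: g_def)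
  have fin: "finite (coverings m T)" if "T \<subseteq> S" for T
    using finite_hpow[of T m] finite_subset[OF that assms(2)] by (simp add: coverings_def)
  have "fwd_diff (X 0) (X m) (iter_map f m) x S u = g S"
  proof (rule B.eq_if_finsum_Pow_eq[OF assms(2)])
    fix T assume T: "T \<subseteq> S"
    have finT: "finite T" using T assms(2) finite_subset by blast
    show "fwd_diff (X 0) (X m) (iter_map f m) x T u \<in> carrier (X m)"
      using T assms(3) by (intro fwd_diff_closed) auto
    show "g T \<in> carrier (X m)" by (rule g_closed[OF T])
    \<comment> \<open>Both subset sums are the value of the composite at \<open>x\<close> plus all directions in \<open>T\<close>.\<close>
    have "(\<Oplus>\<^bsub>X m\<^esub>U\<in>Pow T. fwd_diff (X 0) (X m) (iter_map f m) x U u) =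
        iter_map f m (x \<oplus>\<^bsub>X 0\<^esub> finsum (X 0) u T)"
      using T assms(3) finT by (intro finsum_fwd_diff) auto
    also have "\<dots> = iter_map f m x \<oplus>\<^bsub>X m\<^esub> (\<Oplus>\<^bsub>X m\<^esub>K\<in>hpow m T. ?\<Delta> K)"
      using T assms finT by (intro iter_map_expansion) auto
    also have "hpow m T = (\<Union>U\<in>Pow T - {{}}. coverings m U)"
      using empty by (subst hpow_eq_UN_coverings) auto
    also have "(\<Oplus>\<^bsub>X m\<^esub>K\<in>(\<Union>U\<in>Pow T - {{}}. coverings m U). ?\<Delta> K) =
        (\<Oplus>\<^bsub>X m\<^esub>U\<in>Pow T - {{}}. \<Oplus>\<^bsub>X m\<^esub>K\<in>coverings m U. ?\<Delta> K)"
    proof (rule B.add.finprod_UN_disjoint)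
      show "pairwise (\<lambda>U U'. disjnt (coverings m U) (coverings m U')) (Pow T - {{}})"
        by (auto simp: pairwise_def disjnt_def coverings_def)
    qed (use T finT fin \<Delta> in auto)
    also have "\<dots> = (\<Oplus>\<^bsub>X m\<^esub>U\<in>Pow T - {{}}. g U)"
    proof (rule B.finsum_cong')
      fix U assume "U \<in> Pow T - {{}}"
      then show "(\<Oplus>\<^bsub>X m\<^esub>K\<in>coverings m U. ?\<Delta> K) = g U" by (simp add: g_def)
    qed (use T g_closed in auto)
    also have "iter_map f m x \<oplus>\<^bsub>X m\<^esub> \<dots> = (\<Oplus>\<^bsub>X m\<^esub>U\<in>insert {} (Pow T - {{}}). g U)"
    proof (subst B.finsum_insert)
      show "iter_map f m x \<oplus>\<^bsub>X m\<^esub> (\<Oplus>\<^bsub>X m\<^esub>U\<in>Pow T - {{}}. g U) =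
          g {} \<oplus>\<^bsub>X m\<^esub> (\<Oplus>\<^bsub>X m\<^esub>U\<in>Pow T - {{}}. g U)"
        by (simp add: g_def)
    qed (use T finT g_closed in auto)
    finally show "(\<Oplus>\<^bsub>X m\<^esub>U\<in>Pow T. fwd_diff (X 0) (X m) (iter_map f m) x U u) =
        (\<Oplus>\<^bsub>X m\<^esub>U\<in>Pow T. g U)"
      by (simp add: insert_absorb)
  qed
  then show ?thesis using assms(4) by (simp add: g_def)
qed

text \<open>
  At each level the members of an iterated subset are renumbered as slots of its profile. By the induction
  hypothesis the direction attached to a member depends only on its profile, so the
  renumbering preserves the family of directions.
\<close>

lemma incr_set_eq_incr_multi_profile:
  assumes "K \<in> hpow r T" "r \<le> m" "\<And>t. t \<in> T \<Longrightarrow> u (fst t) \<in> carrier (X 0)"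
  shows "incr_set X f x (\<lambda>(s, i). u s) r K = incr_multi X f x u r (profile K)"
  using assms
proof (induction r T arbitrary: K rule: hpow.induct)
  case (2 T)
  interpret abelian_group_map "X 0" "X 1" "f 1" x
    using map_step[of 0] 2 by simp
  from 2 obtain U where U: "K = PBase U" "fset U \<subseteq> T" by auto
  obtain b where "bij_betw b (fset U) (slots (content fst (fset U)))"
    "\<forall>t\<in>fset U. fst (b t) = fst t"
    using bij_betw_slots_content[of "fset U" fst] by auto
  then have "fwd_diff (X 0) (X 1) (f 1) x (fset U) (\<lambda>(s, i). u s) =
      fwd_diff (X 0) (X 1) (f 1) x (slots (content fst (fset U))) (\<lambda>(s, i). u s)"
    using U 2 by (intro fwd_diff_reindex[where b = b]) (auto simp: split_beta)
  then show ?case using U by simp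
next
  case (3 r T)
  interpret abelian_group_map "X (Suc r)" "X (Suc (Suc r))" "f (Suc (Suc r))" "iter_map f (Suc r) x"
    using map_step[of "Suc r"] 3 by simp
  from 3 obtain K' where K: "K = PNode K'" "fset K' \<subseteq> hpow (Suc r) T" by auto
  let ?w = "incr_set X f x (\<lambda>(s, i). u s) (Suc r)"
  have w: "?w \<in> fset K' \<rightarrow> carrier (X (Suc r))"
    using K 3 by (auto intro!: incr_set_closed[of _ _ T])
  have eq: "?w L = incr_multi X f x u (Suc r) (profile L)" if "L \<in> fset K'" for L
    using that K 3 by auto
  obtain b where "bij_betw b (fset K') (slots (content profile (fset K')))"
    "\<forall>L\<in>fset K'. fst (b L) = profile L"
    using bij_betw_slots_content[of "fset K'" profile] by auto
  then have "fwd_diff (X (Suc r)) (X (Suc (Suc r))) (f (Suc (Suc r))) (iter_map f (Suc r) x)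
        (fset K') ?w =
      fwd_diff (X (Suc r)) (X (Suc (Suc r))) (f (Suc (Suc r))) (iter_map f (Suc r) x)
        (slots (content profile (fset K'))) (\<lambda>(l, i). incr_multi X f x u (Suc r) l)"
    using w eq by (intro fwd_diff_reindex[where b = b]) (auto simp: split_beta)
  then show ?case using K by simp
qed simp

end

lemma profile_in_hmulti:
  "K \<in> hpow r T \<Longrightarrow> fst ` T \<subseteq> S \<Longrightarrow> profile K \<in> hmulti r S"
proof (induction r T arbitrary: K rule: hpow.induct)
  case (2 T)
  then obtain U where U: "K = PBase U" "U \<noteq> {||}" "fset U \<subseteq> T" by auto
  then have "fset U \<noteq> {}" by (metis bot_fset.rep_eq fset_inject)
  then show ?case using U 2 by (auto simp: mset_set_empty_iff)
next
  case (3 r T)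
  then obtain U where U: "K = PNode U" "U \<noteq> {||}" "fset U \<subseteq> hpow (Suc r) T" by auto
  then have "fset U \<noteq> {}" by (metis bot_fset.rep_eq fset_inject)
  moreover have "profile L \<in> hmulti (Suc r) S" if "L \<in> fset U" for L
    using U 3 that by auto
  ultimately show ?case using U by (auto simp: mset_set_empty_iff)
qed simp

lemma fst_slots: "fst ` slots \<gamma> = set_mset \<gamma>"
proof
  show "fst ` slots \<gamma> \<subseteq> set_mset \<gamma>"
    by (auto simp: slots_def simp flip: count_greater_zero_iff)
  show "set_mset \<gamma> \<subseteq> fst ` slots \<gamma>"
  proof
    fix s assume "s \<in># \<gamma>"
    then have "(s, 1) \<in> slots \<gamma>" by (auto simp: slots_def Suc_le_eq)
    then show "s \<in> fst ` slots \<gamma>" by force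
  qed
qed

text \<open>
  Profiles that occur in \<open>\<H>\<close> are exactly the higher multi-indices with nonzero
  count. The count \<open>c\<close> is a parameter so that both coefficient systems are instances, with \<open>\<H>\<close> the
  set of all iterated subsets or the set of coverings.
\<close>

lemma (in abelian_group) finsum_by_profile:
  assumes "\<H> \<subseteq> hpow m (slots \<gamma>)" "set_mset \<gamma> \<subseteq> S"
    and "\<And>K. K \<in> \<H> \<Longrightarrow> v (profile K) \<in> carrier G"
    and "\<And>\<kappa>. c \<kappa> = card {K \<in> \<H>. profile K = \<kappa>}"
  shows "(\<Oplus>K\<in>\<H>. v (profile K)) = (\<Oplus>\<kappa>\<in>{\<kappa> \<in> hmulti m S. c \<kappa> \<noteq> 0}. [c \<kappa>] \<cdot> v \<kappa>)"
proof -
  have fin: "finite \<H>"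
    using assms(1) finite_hpow[OF finite_slots] by (rule finite_subset)
  have "fst ` slots \<gamma> \<subseteq> S"
    using assms(2) by (simp add: fst_slots)
  then have "profile K \<in> hmulti m S" if "K \<in> \<H>" for K
    using that assms(1) profile_in_hmulti by blast
  then have "profile ` \<H> = {\<kappa> \<in> hmulti m S. c \<kappa> \<noteq> 0}"
    using fin by (auto simp: assms(4) card_eq_0_iff)
  then show ?thesis
    using finsum_by_value[of \<H> v profile, OF fin assms(3)] by (simp add: assms(4))
qed

context map_chain
begin

lemma fwd_diff_iter_map_multi:
  assumes "1 \<le> m" "\<gamma> \<noteq> {#}" "set_mset \<gamma> \<subseteq> S" "u \<in> S \<rightarrow> carrier (X 0)"
  shows "fwd_diff (X 0) (X m) (iter_map f m) x (slots \<gamma>) (\<lambda>(s, i). u s) =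
    (\<Oplus>\<^bsub>X m\<^esub>\<kappa>\<in>{\<kappa> \<in> hmulti m S. Cov_coeff m \<gamma> \<kappa> \<noteq> 0}.
      [Cov_coeff m \<gamma> \<kappa>] \<cdot>\<^bsub>X m\<^esub> incr_multi X f x u m \<kappa>)"
proof -
  interpret abelian_group "X m" by (rule groups) simp
  have u: "u (fst t) \<in> carrier (X 0)" if "t \<in> slots \<gamma>" for t
    using imageI[OF that, of fst] assms(3,4) by (auto simp: fst_slots)
  then have u': "(\<lambda>(s, i). u s) \<in> slots \<gamma> \<rightarrow> carrier (X 0)" by auto
  have ne: "slots \<gamma> \<noteq> {}" using assms(2) content_slots[of \<gamma>] by auto
  have eq: "incr_set X f x (\<lambda>(s, i). u s) m K = incr_multi X f x u m (profile K)"
    and closed: "incr_multi X f x u m (profile K) \<in> carrier (X m)" if "K \<in> coverings m (slots \<gamma>)" for K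
    using incr_set_eq_incr_multi_profile[of K m "slots \<gamma>" u] incr_set_closed[OF _ order_refl u', of K] that u u'
    by (auto simp: coverings_def)
  have "fwd_diff (X 0) (X m) (iter_map f m) x (slots \<gamma>) (\<lambda>(s, i). u s) =
      (\<Oplus>\<^bsub>X m\<^esub>K\<in>coverings m (slots \<gamma>). incr_set X f x (\<lambda>(s, i). u s) m K)"
    by (rule fwd_diff_iter_map[OF assms(1) finite_slots u' ne])
  also have "\<dots> = (\<Oplus>\<^bsub>X m\<^esub>K\<in>coverings m (slots \<gamma>). incr_multi X f x u m (profile K))"
    using eq closed by (intro finsum_cong') auto
  also have "\<dots> = (\<Oplus>\<^bsub>X m\<^esub>\<kappa>\<in>{\<kappa> \<in> hmulti m S. Cov_coeff m \<gamma> \<kappa> \<noteq> 0}.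
      [Cov_coeff m \<gamma> \<kappa>] \<cdot>\<^bsub>X m\<^esub> incr_multi X f x u m \<kappa>)"
    using assms(3) closed
    by (intro finsum_by_profile[where \<gamma> = \<gamma>]) (auto simp: coverings_def Cov_coeff_def)
  finally show ?thesis .
qed

lemma iter_map_expansion_multi:
  assumes "1 \<le> m" "finite S" "set_mset \<gamma> \<subseteq> S" "u \<in> S \<rightarrow> carrier (X 0)"
  shows "iter_map f m (x \<oplus>\<^bsub>X 0\<^esub> (\<Oplus>\<^bsub>X 0\<^esub>s\<in>S. [count \<gamma> s] \<cdot>\<^bsub>X 0\<^esub> u s)) =
    iter_map f m x \<oplus>\<^bsub>X m\<^esub>
      (\<Oplus>\<^bsub>X m\<^esub>\<kappa>\<in>{\<kappa> \<in> hmulti m S. Pow_coeff m \<gamma> \<kappa> \<noteq> 0}.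
        [Pow_coeff m \<gamma> \<kappa>] \<cdot>\<^bsub>X m\<^esub> incr_multi X f x u m \<kappa>)"
proof -
  interpret X0: abelian_group "X 0" by (rule groups) simp
  interpret abelian_group "X m" by (rule groups) simp
  have u: "u (fst t) \<in> carrier (X 0)" if "t \<in> slots \<gamma>" for t
    using imageI[OF that, of fst] assms(3,4) by (auto simp: fst_slots)
  then have u': "(\<lambda>(s, i). u s) \<in> slots \<gamma> \<rightarrow> carrier (X 0)" by auto
  have eq: "incr_set X f x (\<lambda>(s, i). u s) m K = incr_multi X f x u m (profile K)"
    and closed: "incr_multi X f x u m (profile K) \<in> carrier (X m)" if "K \<in> hpow m (slots \<gamma>)" for K
    using incr_set_eq_incr_multi_profile[of K m "slots \<gamma>" u] incr_set_closed[OF _ order_refl u', of K] that u u'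
    by auto
  have "(\<Oplus>\<^bsub>X 0\<^esub>s\<in>S. [count \<gamma> s] \<cdot>\<^bsub>X 0\<^esub> u s) = (\<Oplus>\<^bsub>X 0\<^esub>s\<in>fst ` slots \<gamma>. [count \<gamma> s] \<cdot>\<^bsub>X 0\<^esub> u s)"
    using assms(2-4)
    by (intro X0.add.finprod_mono_neutral_cong_right) (auto simp: fst_slots not_in_iff)
  also have "\<dots> = (\<Oplus>\<^bsub>X 0\<^esub>t\<in>slots \<gamma>. u (fst t))"
    using X0.finsum_by_value[of "slots \<gamma>" u fst, OF finite_slots u] content_slots[of \<gamma>]
    by (simp flip: count_content add: finite_slots)
  also have "\<dots> = finsum (X 0) (\<lambda>(s, i). u s) (slots \<gamma>)" by (simp add: case_prod_unfold)
  finally have sum: "(\<Oplus>\<^bsub>X 0\<^esub>s\<in>S. [count \<gamma> s] \<cdot>\<^bsub>X 0\<^esub> u s) = finsum (X 0) (\<lambda>(s, i). u s) (slots \<gamma>)" .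
  have "iter_map f m (x \<oplus>\<^bsub>X 0\<^esub> finsum (X 0) (\<lambda>(s, i). u s) (slots \<gamma>)) =
      iter_map f m x \<oplus>\<^bsub>X m\<^esub> (\<Oplus>\<^bsub>X m\<^esub>K\<in>hpow m (slots \<gamma>). incr_set X f x (\<lambda>(s, i). u s) m K)"
    by (rule iter_map_expansion[OF assms(1) order_refl finite_slots u'])
  also have "(\<Oplus>\<^bsub>X m\<^esub>K\<in>hpow m (slots \<gamma>). incr_set X f x (\<lambda>(s, i). u s) m K) =
      (\<Oplus>\<^bsub>X m\<^esub>K\<in>hpow m (slots \<gamma>). incr_multi X f x u m (profile K))"
    using eq closed by (intro finsum_cong') auto
  also have "\<dots> = (\<Oplus>\<^bsub>X m\<^esub>\<kappa>\<in>{\<kappa> \<in> hmulti m S. Pow_coeff m \<gamma> \<kappa> \<noteq> 0}.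
      [Pow_coeff m \<gamma> \<kappa>] \<cdot>\<^bsub>X m\<^esub> incr_multi X f x u m \<kappa>)"
    using assms(3) closed
    by (intro finsum_by_profile[where \<gamma> = \<gamma>]) (auto simp: Pow_coeff_def)
  finally show ?thesis by (simp only: sum)
qed

end

section \<open>The expansion theorem\<close>

theorem theorem3:
  fixes X :: "nat \<Rightarrow> ('a, 'm) ring_scheme"
    and f :: "nat \<Rightarrow> 'a \<Rightarrow> 'a"
    and m :: nat
    and x :: 'a
    and S :: "'s set"
    and u :: "'s \<Rightarrow> 'a"
    and \<gamma> :: "'s multiset"
  assumes "m \<ge> 1"
    and "\<And>i. i \<le> m \<Longrightarrow> abelian_group (X i)"
    and "\<And>i. 1 \<le> i \<Longrightarrow> i \<le> m \<Longrightarrow> f i \<in> carrier (X (i - 1)) \<rightarrow> carrier (X i)"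
    and "x \<in> carrier (X 0)"
    and "finite S"
    and "u \<in> S \<rightarrow> carrier (X 0)"
    and "set_mset \<gamma> \<subseteq> S"
  shows
    "(S \<noteq> {} \<longrightarrow>
        fwd_diff (X 0) (X m) (iter_map f m) x S u =
          (\<Oplus>\<^bsub>X m\<^esub>K\<in>coverings m S. incr_set X f x u m K))
     \<and>
     (\<gamma> \<noteq> {#} \<longrightarrow>
        fwd_diff (X 0) (X m) (iter_map f m) x (slots \<gamma>) (\<lambda>(s, i). u s) =
          (\<Oplus>\<^bsub>X m\<^esub>\<kappa>\<in>{\<kappa> \<in> hmulti m S. Cov_coeff m \<gamma> \<kappa> \<noteq> 0}.
             [Cov_coeff m \<gamma> \<kappa>] \<cdot>\<^bsub>X m\<^esub> incr_multi X f x u m \<kappa>))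
     \<and>
     iter_map f m (x \<oplus>\<^bsub>X 0\<^esub> (\<Oplus>\<^bsub>X 0\<^esub>s\<in>S. [count \<gamma> s] \<cdot>\<^bsub>X 0\<^esub> u s)) =
       iter_map f m x \<oplus>\<^bsub>X m\<^esub>
         (\<Oplus>\<^bsub>X m\<^esub>\<kappa>\<in>{\<kappa> \<in> hmulti m S. Pow_coeff m \<gamma> \<kappa> \<noteq> 0}.
            [Pow_coeff m \<gamma> \<kappa>] \<cdot>\<^bsub>X m\<^esub> incr_multi X f x u m \<kappa>)
     \<and>
     (\<forall>\<kappa>\<in>hmulti m S.
        int (Cov_coeff m \<gamma> \<kappa>) =
          (\<Sum>\<beta> | \<beta> \<subseteq># \<gamma>. (-1) ^ size (\<gamma> - \<beta>) * int (mbinom S \<gamma> \<beta>) * int (Pow_coeff m \<beta> \<kappa>))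
        \<and>
        Pow_coeff m \<gamma> \<kappa> = (\<Sum>\<beta> | \<beta> \<subseteq># \<gamma>. mbinom S \<gamma> \<beta> * Cov_coeff m \<beta> \<kappa>))
     \<and>
     (\<forall>\<alpha>. MBase \<alpha> \<in> hmulti 1 S \<longrightarrow>
        Pow_coeff 1 \<gamma> (MBase \<alpha>) = mbinom S \<gamma> \<alpha> \<and>
        Cov_coeff 1 \<gamma> (MBase \<alpha>) = (if \<gamma> = \<alpha> then 1 else 0))
     \<and>
     (m \<ge> 2 \<longrightarrow> (\<forall>\<kappa>. MNode \<kappa> \<in> hmulti m S \<longrightarrow>
        of_nat (Pow_coeff m \<gamma> (MNode \<kappa>)) =
          1 / of_nat (mfact \<kappa>) *
            (\<Prod>l\<in>set_mset \<kappa>. falling (of_nat (Pow_coeff (m - 1) \<gamma> l)) (count \<kappa> l))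
        \<and>
        of_nat (Cov_coeff m \<gamma> (MNode \<kappa>)) =
          (\<Sum>\<beta> | \<beta> \<subseteq># \<gamma>. (-1) ^ size (\<gamma> - \<beta>) * of_nat (mbinom S \<gamma> \<beta>) *
             (1 / of_nat (mfact \<kappa>) *
               (\<Prod>l\<in>set_mset \<kappa>.
                  falling (\<Sum>\<alpha> | \<alpha> \<subseteq># \<beta>. of_nat (mbinom S \<beta> \<alpha>) * of_nat (Cov_coeff (m - 1) \<alpha> l))
                    (count \<kappa> l))))))"
proof -
  interpret map_chain X f m x
    by (rule map_chain.intro) (use assms(2-4) in auto)
  have part1: "S \<noteq> {} \<longrightarrow>
      fwd_diff (X 0) (X m) (iter_map f m) x S u =
        (\<Oplus>\<^bsub>X m\<^esub>K\<in>coverings m S. incr_set X f x u m K)"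
    using fwd_diff_iter_map[OF assms(1,5,6)] by blast
  have part2: "\<gamma> \<noteq> {#} \<longrightarrow>
      fwd_diff (X 0) (X m) (iter_map f m) x (slots \<gamma>) (\<lambda>(s, i). u s) =
        (\<Oplus>\<^bsub>X m\<^esub>\<kappa>\<in>{\<kappa> \<in> hmulti m S. Cov_coeff m \<gamma> \<kappa> \<noteq> 0}.
           [Cov_coeff m \<gamma> \<kappa>] \<cdot>\<^bsub>X m\<^esub> incr_multi X f x u m \<kappa>)"
    using fwd_diff_iter_map_multi[OF assms(1) _ assms(7,6)] by blast
  note part3 = iter_map_expansion_multi[OF assms(1,5,7,6)]
  have part4: "\<forall>\<kappa>\<in>hmulti m S.
      int (Cov_coeff m \<gamma> \<kappa>) =
        (\<Sum>\<beta> | \<beta> \<subseteq># \<gamma>. (-1) ^ size (\<gamma> - \<beta>) * int (mbinom S \<gamma> \<beta>) * int (Pow_coeff m \<beta> \<kappa>))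
      \<and>
      Pow_coeff m \<gamma> \<kappa> = (\<Sum>\<beta> | \<beta> \<subseteq># \<gamma>. mbinom S \<gamma> \<beta> * Cov_coeff m \<beta> \<kappa>)"
    by (intro ballI conjI Cov_coeff_moebius[OF _ assms(5,7)]
        Pow_coeff_eq_sum_Cov_coeff[OF _ assms(5,7)])
  have part5_base: "\<forall>\<alpha>. MBase \<alpha> \<in> hmulti 1 S \<longrightarrow>
      Pow_coeff 1 \<gamma> (MBase \<alpha>) = mbinom S \<gamma> \<alpha> \<and>
      Cov_coeff 1 \<gamma> (MBase \<alpha>) = (if \<gamma> = \<alpha> then 1 else 0)"
    by (intro allI impI conjI Pow_coeff_MBase[OF _ assms(5)] Cov_coeff_MBase)
  have part5_step: "m \<ge> 2 \<longrightarrow> (\<forall>\<kappa>. MNode \<kappa> \<in> hmulti m S \<longrightarrow>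
      of_nat (Pow_coeff m \<gamma> (MNode \<kappa>)) =
        1 / of_nat (mfact \<kappa>) *
          (\<Prod>l\<in>set_mset \<kappa>. falling (of_nat (Pow_coeff (m - 1) \<gamma> l)) (count \<kappa> l))
      \<and>
      of_nat (Cov_coeff m \<gamma> (MNode \<kappa>)) =
        (\<Sum>\<beta> | \<beta> \<subseteq># \<gamma>. (-1) ^ size (\<gamma> - \<beta>) * of_nat (mbinom S \<gamma> \<beta>) *
           (1 / of_nat (mfact \<kappa>) *
             (\<Prod>l\<in>set_mset \<kappa>.
                falling (\<Sum>\<alpha> | \<alpha> \<subseteq># \<beta>. of_nat (mbinom S \<beta> \<alpha>) * of_nat (Cov_coeff (m - 1) \<alpha> l))
                  (count \<kappa> l)))))"
  proof (intro impI allI)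
    fix \<kappa>
    assume "m \<ge> 2" and \<kappa>: "MNode \<kappa> \<in> hmulti m S"
    then obtain r where m: "m = Suc (Suc r)" by (metis add_2_eq_Suc le_Suc_ex)
    then have pred: "m - 1 = Suc r" by simp
    have "\<kappa> \<noteq> {#}" using \<kappa> by (auto simp: m)
    then show "of_nat (Pow_coeff m \<gamma> (MNode \<kappa>)) =
        1 / of_nat (mfact \<kappa>) *
          (\<Prod>l\<in>set_mset \<kappa>. falling (of_nat (Pow_coeff (m - 1) \<gamma> l)) (count \<kappa> l))
      \<and>
      of_nat (Cov_coeff m \<gamma> (MNode \<kappa>)) =
        (\<Sum>\<beta> | \<beta> \<subseteq># \<gamma>. (-1) ^ size (\<gamma> - \<beta>) * of_nat (mbinom S \<gamma> \<beta>) *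
           (1 / of_nat (mfact \<kappa>) *
             (\<Prod>l\<in>set_mset \<kappa>.
                falling (\<Sum>\<alpha> | \<alpha> \<subseteq># \<beta>. of_nat (mbinom S \<beta> \<alpha>) * of_nat (Cov_coeff (m - 1) \<alpha> l))
                  (count \<kappa> l))))"
      unfolding pred
      by (intro conjI) (use Pow_coeff_MNode Cov_coeff_MNode[OF _ assms(5,7)] \<kappa> in \<open>simp_all only: m\<close>)
  qed
  show ?thesis
    by (rule conjI[OF part1 conjI[OF part2 conjI[OF part3
          conjI[OF part4 conjI[OF part5_base part5_step]]]]])
qed

end
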